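(* Let $p$ be a prime and let $G\cong\bigoplus_{i=1}^s G_i$ be a bounded abelian $p$-group, where $G_i\cong(\mathbb Z_{p^{n_i}})^{r_i}$ is homocyclic of $p$-rank $r_i$ and $0<n_1<\cdots<n_s$. Let $\mathcal E=\operatorname{End}(G)$ with Jacobson radical $\mathcal J$, let $\Delta(G)=1+\mathcal J$ be the maximal normal $p$-subgroup of $\operatorname{Aut}(G)$, let $\{\mathcal J_t\}$ be the upper annihilating sequence of $\mathcal J$, let $\{\mathcal Z_t\}$ be the upper central series of $\Delta(G)$, and let $Z=\mathcal Z\cap\Delta(G)$, where $\mathcal Z$ is the center of the ring $\mathcal E$. Suppose that one of the following holds: (1) $p\ge 3$; (2) $p=2$ and $\sigma(G)\ge 2$; (3) $p=2$, $r_s>1$ and $s\ge 2$. Then for every $t\ge 1$, $$\mathcal Z_t=(\mathcal J_t+1)Z .$$ Moreover, $\mathcal Z_t$ is the set of all $C+1\in\Delta(G)$, with $C=(c_{ij}^{(l,k)})$, such that - $c_{ij}^{(l,k)}\equiv 0 \pmod{p^{n_j-\alpha(i,j,t)}}$ for all $i\neq j$ and all $l,k$; - $c_{ii}^{(l,l)}\equiv c_{ss}^{(r,r)} \pmod{p^{n_i-\alpha(i,i,t)}}$ for all $i\le s$ and all $l$; - $c_{ii}^{(l,k)}\equiv 0 \pmod{p^{n_i-\alpha(i,i,t)}}$ for all $i$ and all $l\ne k$.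
   Context: Matrix representation: an endomorphism of $G$ is identified with a matrix $A=(A_{ij})_{s\times s}$, $A_{ij}\in\mathcal E_{ij}=\operatorname{Hom}(G_i,G_j)$, where $f(x)=\sum_j f_{ij}(x)$ for $x\in G_i$; products are $(AB)_{ij}=\sum_k A_{ik}B_{kj}$. Fixing a basis of each $G_i$ (as a direct sum of cyclic groups of order $p^{n_i}$), $A_{ij}$ is an $r_i\times r_j$ (row-finite) matrix $(a_{ij}^{(l,k)})$ with entries in $\mathbb Z_{p^{n_j}}$, where $l$ runs over the basis of $G_i$ and $k$ over the basis of $G_j$; if $i<j$ all entries are divisible by $p^{n_j-n_i}$. The Jacobson radical $\mathcal J$ consists of the $A\in\mathcal E$ with $A_{ii}\in p\,\mathcal E_{ii}$ for all $i$. The superscript $r$ ($r=\sum_i r_i$) denotes the last basis element, a fixed basis element of $G_s$; $c_{ss}^{(r,r)}$ is the corresponding diagonal entry. $\sigma(G)=\min_{2\le j\le s}(n_j-n_{j-1})$. Upper annihilating sequence: $\mathcal J_0=0$ and, for $t\ge1$, $\mathcal J_t=\{a\in\mathcal J: a\mathcal J\subseteq\mathcal J_{t-1},\ \mathcal J a\subseteq\mathcal J_{t-1}\}$. Upper function $\alpha(i,j,t)$ ($1\le i,j\le s$, $t\ge1$): $\alpha(s,s,1)=1$, $\alpha(i,j,1)=0$ for $(i,j)\ne(s,s)$, and for $t\ge2$, $\alpha(i,j,t)$ is the minimum of $n_j-n_{j-1}+\alpha(i,j-1,t-1)$, $n_i-n_{i-1}+\alpha(i-1,j,t-1)$, $\alpha(i,j,t-1)+1$,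 $\alpha(i+1,j,t-1)$, $\alpha(i,j+1,t-1)$, where terms involving an index outside $\{1,\dots,s\}$ are omitted. A congruence modulo $p^{m}$ with $m\le 0$ is vacuous. *)

theory Defs
  imports "HOL-Algebra.Algebra" "HOL-Number_Theory.Cong" "HOL-Library.Extended_Nat"
begin

definition left_ideal :: "'a set \<Rightarrow> ('a, 'm) ring_scheme \<Rightarrow> bool" where
  "left_ideal I R \<longleftrightarrow>
     additive_subgroup I R \<and> (\<forall>x\<in>carrier R. \<forall>a\<in>I. x \<otimes>\<^bsub>R\<^esub> a \<in> I)"

definition maximal_left_ideal :: "'a set \<Rightarrow> ('a, 'm) ring_scheme \<Rightarrow> bool" where
  "maximal_left_ideal M R \<longleftrightarrow>
     left_ideal M R \<and> M \<noteq> carrier R \<and>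
     (\<forall>I. left_ideal I R \<longrightarrow> M \<subseteq> I \<longrightarrow> I = M \<or> I = carrier R)"

text \<open>The intersection with \<open>carrier R\<close> only matters for the zero ring, which has no maximal
  left ideals.\<close>

definition jacobson_radical :: "('a, 'm) ring_scheme \<Rightarrow> 'a set" where
  "jacobson_radical R = carrier R \<inter> \<Inter>{M. maximal_left_ideal M R}"

definition ring_center :: "('a, 'm) ring_scheme \<Rightarrow> 'a set" where
  "ring_center R = {z \<in> carrier R. \<forall>x\<in>carrier R. z \<otimes>\<^bsub>R\<^esub> x = x \<otimes>\<^bsub>R\<^esub> z}"

primrec upper_annihilating :: "('a, 'm) ring_scheme \<Rightarrow> nat \<Rightarrow> 'a set" where
  "upper_annihilating R 0 = {\<zero>\<^bsub>R\<^esub>}"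
| "upper_annihilating R (Suc t) =
     {a \<in> jacobson_radical R. \<forall>b\<in>jacobson_radical R.
        a \<otimes>\<^bsub>R\<^esub> b \<in> upper_annihilating R t \<and> b \<otimes>\<^bsub>R\<^esub> a \<in> upper_annihilating R t}"

primrec upper_central :: "('a, 'm) monoid_scheme \<Rightarrow> nat \<Rightarrow> 'a set" where
  "upper_central H 0 = {\<one>\<^bsub>H\<^esub>}"
| "upper_central H (Suc t) =
     {x \<in> carrier H. \<forall>y\<in>carrier H.
        x \<otimes>\<^bsub>H\<^esub> y \<otimes>\<^bsub>H\<^esub> inv\<^bsub>H\<^esub> x \<otimes>\<^bsub>H\<^esub> inv\<^bsub>H\<^esub> y \<in> upper_central H t}"

text \<open>The group is written multiplicatively, so the ring sum is the pointwise group product.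
  Endomorphisms act on the right: \<open>f \<otimes> g\<close> is \<open>f\<close> followed by \<open>g\<close>.  Hence for the matrix
  entries below, \<open>(AB)\<^sub>i\<^sub>j\<close> is the sum of the \<open>A\<^sub>i\<^sub>k B\<^sub>k\<^sub>j\<close>.\<close>

definition End_ring :: "('a, 'm) monoid_scheme \<Rightarrow> ('a \<Rightarrow> 'a) ring" where
  "End_ring G =
     \<lparr>carrier = hom G G \<inter> extensional (carrier G),
      monoid.mult = (\<lambda>f g. compose (carrier G) g f),
      monoid.one = (\<lambda>x\<in>carrier G. x),
      ring.zero = (\<lambda>x\<in>carrier G. \<one>\<^bsub>G\<^esub>),
      ring.add = (\<lambda>f g. \<lambda>x\<in>carrier G. f x \<otimes>\<^bsub>G\<^esub> g x)\<rparr>"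

text \<open>\<open>Delta G\<close> is the subgroup \<open>1 + J\<close> of the automorphism group, the unit group of the
  endomorphism ring.\<close>

definition Delta :: "('a, 'm) monoid_scheme \<Rightarrow> ('a \<Rightarrow> 'a) monoid" where
  "Delta G =
     (units_of (End_ring G))
       \<lparr>carrier := jacobson_radical (End_ring G) +>\<^bsub>End_ring G\<^esub> \<one>\<^bsub>End_ring G\<^esub>\<rparr>"

text \<open>The direct sum of copies of the integers modulo \<open>m\<close> indexed by \<open>B\<close>; the basis index set
  \<open>B\<close> may be infinite.\<close>

definition homocyclic_group :: "nat \<Rightarrow> 'b set \<Rightarrow> ('b \<Rightarrow> int) monoid" where
  "homocyclic_group m B = sum_group B (\<lambda>_. integer_mod_group m)"

definition homocyclic_sum ::
  "nat \<Rightarrow> nat \<Rightarrow> (nat \<Rightarrow> nat) \<Rightarrow> (nat \<Rightarrow> 'b set) \<Rightarrow> (nat \<Rightarrow> 'b \<Rightarrow> int) monoid" where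
  "homocyclic_sum p s n B = sum_group {1..s} (\<lambda>i. homocyclic_group (p ^ n i) (B i))"

definition basis_vector ::
  "nat \<Rightarrow> (nat \<Rightarrow> 'b set) \<Rightarrow> nat \<Rightarrow> 'b \<Rightarrow> (nat \<Rightarrow> 'b \<Rightarrow> int)" where
  "basis_vector s B i l = (\<lambda>j\<in>{1..s}. \<lambda>k\<in>B j. if j = i \<and> k = l then 1 else 0)"

text \<open>For an isomorphism \<open>\<phi>\<close> from \<open>G\<close> onto \<open>homocyclic_sum p s n B\<close>, the entry
  \<open>a\<^sub>i\<^sub>j\<close> with superscript \<open>(l,k)\<close> of the endomorphism \<open>f\<close>: the coordinate at \<open>k \<in> B j\<close> of the
  image of the basis element \<open>l \<in> B i\<close>, represented by an integer between \<open>0\<close> and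
  \<open>p ^ n j - 1\<close>.\<close>

definition matrix_entry ::
  "('a, 'm) monoid_scheme \<Rightarrow> ('a \<Rightarrow> nat \<Rightarrow> 'b \<Rightarrow> int) \<Rightarrow> nat \<Rightarrow> (nat \<Rightarrow> 'b set) \<Rightarrow>
   ('a \<Rightarrow> 'a) \<Rightarrow> nat \<Rightarrow> nat \<Rightarrow> 'b \<Rightarrow> 'b \<Rightarrow> int" where
  "matrix_entry G \<phi> s B f i j l k =
     \<phi> (f (inv_into (carrier G) \<phi> (basis_vector s B i l))) j k"

text \<open>The minimum is taken in \<^typ>\<open>enat\<close>, so it is \<open>\<infinity>\<close> when \<open>s = 1\<close>.\<close>

definition min_gap :: "nat \<Rightarrow> (nat \<Rightarrow> nat) \<Rightarrow> enat" where
  "min_gap s n = (INF j\<in>{2..s}. enat (n j - n (j - 1)))"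

text \<open>Only the values at \<open>t \<ge> 1\<close> and \<open>i, j \<in> {1..s}\<close> are meaningful; the value at \<open>t = 0\<close> is a
  dummy.  The value may exceed \<open>n j\<close>; then the truncated difference
  \<open>n j - upper_fun s n i j t\<close> is \<open>0\<close>, and a congruence modulo that power of \<open>p\<close> is
  vacuous.\<close>

fun upper_fun :: "nat \<Rightarrow> (nat \<Rightarrow> nat) \<Rightarrow> nat \<Rightarrow> nat \<Rightarrow> nat \<Rightarrow> nat" where
  "upper_fun s n i j 0 = 0"
| "upper_fun s n i j (Suc 0) = (if i = s \<and> j = s then 1 else 0)"
| "upper_fun s n i j (Suc (Suc t)) = Min
     ({upper_fun s n i j (Suc t) + 1} \<union>
      (if 1 < j then {n j - n (j - 1) + upper_fun s n i (j - 1) (Suc t)} else {}) \<union>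
      (if 1 < i then {n i - n (i - 1) + upper_fun s n (i - 1) j (Suc t)} else {}) \<union>
      (if i < s then {upper_fun s n (i + 1) j (Suc t)} else {}) \<union>
      (if j < s then {upper_fun s n i (j + 1) (Suc t)} else {}))"

end

theory Submission
  imports Defs
begin

text \<open>The recursion for the upper function also holds at \<open>t = 1\<close> with the value \<open>0\<close> at \<open>t = 0\<close>, so
  \<open>\<alpha>(i, j, t)\<close> is the least cost of \<open>t\<close> steps of two independent walks on the levels, starting at \<open>i\<close>
  and \<open>j\<close>.  Multiplication by elementary matrices turns the recursion into the description of
  \<open>J\<^sub>t\<close> by divisibility of the entries.  For \<open>x = 1 + a\<close> and \<open>y = 1 + b\<close> with \<open>a, b\<close> in \<open>J\<close>,
  \<open>[x, y] y x = y x + (a b - b a)\<close>.  If \<open>[x, y]\<close> lies in \<open>(1 + J\<^sub>t) Z\<close>, then \<open>a b - b a\<close> is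
  congruent to \<open>c y x\<close> modulo \<open>J\<^sub>t\<close> for a scalar \<open>c\<close>, and comparing diagonal entries for elementary \<open>b\<close>
  shows that \<open>c\<close> lies in \<open>J\<^sub>t\<close>; this is where the three alternatives on \<open>p\<close> are needed.  Hence \<open>x\<close> is in the
  next term of the upper central series if and only if \<open>a b - b a\<close> is in \<open>J\<^sub>t\<close> for all \<open>b\<close>, and testing this
  with elementary \<open>b\<close> shows that \<open>a\<close> differs from an element of the next \<open>J\<^sub>t\<close> by a scalar.\<close>

section \<open>The upper function as a convolution of walk costs\<close>

text \<open>The recursion couples both indices and hides two facts that diagonal entries need:
  \<open>\<alpha>(j, j, t + 1) = \<alpha>(j, j + 1, t)\<close>, and that
  \<open>n i - \<alpha>(i, i, t)\<close> does not decrease with \<open>i\<close>. With two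
  independent walks both come from handing an excursion from one walk to the other. The first makes
  the comparison of diagonal entries at adjacent levels sharp enough; the second lets one scalar,
  read off at level \<open>s\<close>, serve all levels. The alternatives on \<open>p\<close> answer
  to one configuration. For elementary \<open>b\<close> at \<open>(x, y)\<close> with
  \<open>x \<noteq> y\<close>, the diagonal of \<open>a b - b a\<close> is zero outside
  \<open>x\<close> and \<open>y\<close>, so a third basis element of the top level kills
  \<open>c\<close> at once. If the top level has a single basis element and it is \<open>x\<close>
  or \<open>y\<close>, the diagonal holds \<open>h\<close> at level \<open>s\<close> and
  \<open>- h\<close> at level \<open>s - 1\<close>. Then either \<open>h\<close> already vanishes
  modulo the required power, or the moduli at the two levels agree and adding gives
  \<open>2 c\<close> up to a unit. The latter settles odd \<open>p\<close>; for \<open>p = 2\<close>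
  a gap of at least 2 forces the former.\<close>

fun walk_cost :: "nat \<Rightarrow> (nat \<Rightarrow> nat) \<Rightarrow> nat \<Rightarrow> nat \<Rightarrow> nat" where
  "walk_cost s n i 0 = 0"
| "walk_cost s n i (Suc T) = Min
     ({walk_cost s n i T + 1} \<union>
      (if i < s then {walk_cost s n (i + 1) T} else {}) \<union>
      (if 1 < i then {n i - n (i - 1) + walk_cost s n (i - 1) T} else {}))"

declare walk_cost.simps(2) [simp del] upper_fun.simps(3) [simp del]

locale level_chain =
  fixes s :: nat and n :: "nat \<Rightarrow> nat"
  assumes s_ge: "1 \<le> s" and n_pos: "0 < n 1" and n_mono: "strict_mono_on {1..s} n"
begin

abbreviation "w \<equiv> walk_cost s n"
abbreviation "\<alpha> \<equiv> upper_fun s n"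

lemma n_less: "1 \<le> i \<Longrightarrow> i < j \<Longrightarrow> j \<le> s \<Longrightarrow> n i < n j"
  using n_mono by (auto simp: strict_mono_on_def)

lemma n_le: "1 \<le> i \<Longrightarrow> i \<le> j \<Longrightarrow> j \<le> s \<Longrightarrow> n i \<le> n j"
  using n_less[of i j] by (cases "i = j") auto

lemma n_gt0: "1 \<le> i \<Longrightarrow> i \<le> s \<Longrightarrow> 0 < n i"
  using n_le[of 1 i] n_pos by auto

lemma
  shows w_stay: "w i (Suc T) \<le> w i T + 1"
    and w_up: "i < s \<Longrightarrow> w i (Suc T) \<le> w (Suc i) T"
    and w_down: "1 \<le> i \<Longrightarrow> w (Suc i) (Suc T) \<le> n (Suc i) - n i + w i T"
  unfolding walk_cost.simps by (rule Min_le; simp)+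

lemma w_Suc_cases:
  obtains (stay) "w i (Suc T) = w i T + 1"
  | (up) "i < s" "w i (Suc T) = w (Suc i) T"
  | (down) j where "1 \<le> j" "i = Suc j" "w i (Suc T) = n i - n j + w j T"
proof -
  let ?A = "{w i T + 1} \<union> (if i < s then {w (i + 1) T} else {}) \<union>
      (if 1 < i then {n i - n (i - 1) + w (i - 1) T} else {})"
  have "Min ?A \<in> ?A" by (rule Min_in) auto
  then have "w i (Suc T) \<in> ?A" by (simp add: walk_cost.simps(2))
  then show thesis
    using stay up down[of "i - 1"] by (auto split: if_splits)
qed

lemma w_mono_Suc: "w i T \<le> w i (Suc T)"
proof (induction T arbitrary: i)
  case (Suc T)
  show ?case
  proof (cases rule: w_Suc_cases[of i "Suc T"])
    case stay
    then show ?thesis by simp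
  next
    case up
    then show ?thesis using w_up[of i T] Suc[of "Suc i"] by linarith
  next
    case (down j)
    then show ?thesis using w_down[of j T] Suc[of j] by simp
  qed
qed simp

lemma w_le_up:
  assumes "i < s"
  shows "w i T \<le> w (Suc i) T"
proof (cases T)
  case (Suc T')
  then show ?thesis using w_up[OF assms, of T'] w_mono_Suc[of "Suc i" T'] by simp
qed simp

lemma w_le_down:
  assumes "1 \<le> i"
  shows "w (Suc i) T \<le> n (Suc i) - n i + w i T"
proof (cases T)
  case (Suc T')
  then show ?thesis using w_down[OF assms, of T'] w_mono_Suc[of i T'] by simp
qed simp

text \<open>A radical matrix links arbitrary levels, not only neighbours. One adjacent step is taken
  by the walk; the remaining levels are covered by \<open>w_le_up\<close>, which uses up no
  step.\<close>

lemma w_Suc_le_higher: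
  assumes "k < j" "j \<le> s"
  shows "w k (Suc T) \<le> w j T"
  using assms(1)[THEN Suc_leI] assms(2)
proof (induction j rule: dec_induct)
  case base
  then show ?case using w_up[of k T] by simp
next
  case (step j)
  then show ?case using w_le_up[of j T] by simp
qed

lemma w_Suc_le_lower:
  assumes "1 \<le> j" "j < k" "k \<le> s"
  shows "w k (Suc T) \<le> n k - n j + w j T"
  using assms(2)[THEN Suc_leI] assms(3)
proof (induction k rule: dec_induct)
  case base
  then show ?case using w_down[of j T] assms by simp
next
  case (step k)
  have "n j \<le> n k" "n k \<le> n (Suc k)" using step assms n_le[of j k] n_le[of k "Suc k"] by auto
  then show ?case using step assms w_le_down[of k "Suc T"] by simp
qed

text \<open>At most \<open>s - i\<close> steps are free before the top is reached. Staying and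
  descending cost at least 1, and a descent also makes one further free step possible, hence the
  factor 2. This growth is behind the nilpotency of the radical.\<close>

lemma w_growth:
  assumes "1 \<le> i" "i \<le> s"
  shows "T \<le> 2 * w i T + (s - i)"
  using assms
proof (induction T arbitrary: i)
  case (Suc T)
  show ?case
  proof (cases rule: w_Suc_cases[of i "T"])
    case stay
    then show ?thesis using Suc by fastforce
  next
    case up
    then show ?thesis using Suc.IH[of "Suc i"] Suc.prems by simp
  next
    case (down j)
    then show ?thesis using Suc.IH[of j] Suc.prems n_less[of j i] by simp
  qed
qed simp

lemma w_up_steps:
  assumes "e \<le> b" "b \<le> s"
  shows "w e ((b - e) + U) \<le> w b U"
  using assms
proof (induction e rule: inc_induct)
  case (step e)
  then have "w e (Suc ((b - Suc e) + U)) \<le> w (Suc e) ((b - Suc e) + U)"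
    by (intro w_up) auto
  moreover have "Suc ((b - Suc e) + U) = (b - e) + U" using step by simp
  ultimately show ?case using step by simp
qed simp

lemma w_le_1: "T \<le> 1 \<Longrightarrow> w i T \<le> 1"
  using w_stay[of i 0] by (cases T) auto

text \<open>An optimal walk starting at or below level \<open>b\<close> that is long enough to leave the levels up
  to \<open>b\<close> may be assumed to do so: it first reaches \<open>b\<close>, after \<open>k\<close> steps of cost \<open>c\<close>, and then
  steps up.\<close>

lemma w_crossing:
  assumes "1 \<le> e" "e \<le> b" "b < s"
  shows "T \<le> b - e \<or> (\<exists>k c. k < T \<and> w (Suc b) (T - 1 - k) + c \<le> w e T \<and>
           (\<forall>U. w e (k + U) \<le> c + w b U))"
  using assms(1,2)
proof (induction T arbitrary: e)
  case (Suc T)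
  show ?case
  proof (cases "Suc T \<le> b - e")
    case long: False
    show ?thesis
    proof (cases rule: w_Suc_cases[of e "T"])
      case stay
      show ?thesis
      proof (cases "T \<le> b - e")
        case True
        \<comment> \<open>Exactly \<open>b - e\<close> steps follow the stay. Climbing without the
          stay reaches \<open>b\<close> for free, and the saved step is the crossing to
          \<open>b + 1\<close>, with nothing left to walk.\<close>
        then have T: "T = b - e" using long by simp
        have "w e (T + U) \<le> w b U" for U using w_up_steps[of e b U] Suc.prems assms T by simp
        then show ?thesis
          using stay by (intro disjI2 exI[of _ T] exI[of _ 0]) simp
      next
        case False
        then obtain k c where kX: "k < T" "w (Suc b) (T - 1 - k) + c \<le> w e T"
          "\<And>U. w e (k + U) \<le> c + w b U"
          using Suc.IH[OF Suc.prems] by blast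
        have "w e (Suc k + U) \<le> Suc c + w b U" for U
          using kX(3)[of U] w_stay[of e "k + U"] by simp
        then show ?thesis
          using stay kX(1,2) by (intro disjI2 exI[of _ "Suc k"] exI[of _ "Suc c"]) auto
      qed
    next
      case up
      show ?thesis
      proof (cases "e = b")
        case True
        then show ?thesis using up by (intro disjI2 exI[of _ 0] exI[of _ 0]) auto
      next
        case False
        then have e: "Suc e \<le> b" using Suc.prems by simp
        then obtain k c where kX: "k < T" "w (Suc b) (T - 1 - k) + c \<le> w (Suc e) T"
          "\<And>U. w (Suc e) (k + U) \<le> c + w b U"
          using Suc.IH[of "Suc e"] Suc.prems long by fastforce
        have "w e (Suc k + U) \<le> c + w b U" for U
          using kX(3)[of U] w_up[of e "k + U"] up by simp
        then show ?thesis
          using up kX(1,2) by (intro disjI2 exI[of _ "Suc k"] exI[of _ c]) auto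
      qed
    next
      case (down j)
      show ?thesis
      proof (cases "T \<le> b - j")
        case True
        \<comment> \<open>After the descent the walk is too short to leave the levels up to
          \<open>b\<close>, although it is long enough without it. Climbing at once leaves at most
          one step above \<open>b\<close>, whose cost of at most 1 is covered by the price of the
          descent.\<close>
        have "n j < n e" using down Suc.prems assms n_less[of j e] by simp
        moreover have "w (Suc b) (Suc T - 1 - (b - e)) \<le> 1"
          using True down Suc.prems by (intro w_le_1) auto
        moreover have "w e ((b - e) + U) \<le> w b U" for U
          using w_up_steps[of e b U] Suc.prems assms by simp
        ultimately show ?thesis
          using long down by (intro disjI2 exI[of _ "b - e"] exI[of _ 0]) auto
      next
        case False
        then obtain k c where kX: "k < T" "w (Suc b) (T - 1 - k) + c \<le> w j T"
          "\<And>U. w j (k + U) \<le> c + w b U"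
          using Suc.IH[of j] Suc.prems down by fastforce
        have "w e (Suc k + U) \<le> (n e - n j + c) + w b U" for U
          using kX(3)[of U] w_down[of j "k + U"] down by simp
        then show ?thesis
          using down kX(1,2) by (intro disjI2 exI[of _ "Suc k"] exI[of _ "n e - n j + c"]) auto
      qed
    qed
  qed simp
qed simp

section \<open>The recursion of \<alpha> and its splitting into two walks\<close>

lemma upper_fun_Suc:
  assumes "i \<in> {1..s}" "j \<in> {1..s}"
  shows "\<alpha> i j (Suc t) = Min
     ({\<alpha> i j t + 1} \<union>
      (if 1 < j then {n j - n (j - 1) + \<alpha> i (j - 1) t} else {}) \<union>
      (if 1 < i then {n i - n (i - 1) + \<alpha> (i - 1) j t} else {}) \<union>
      (if i < s then {\<alpha> (i + 1) j t} else {}) \<union>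
      (if j < s then {\<alpha> i (j + 1) t} else {}))" (is "_ = Min ?A")
proof (cases t)
  case t: 0
  have fin: "finite ?A" by simp
  show ?thesis
  proof (cases "i = s \<and> j = s")
    \<comment> \<open>At the top neither index can climb, and every other option costs at least 1;
      at all other pairs a free climb gives 0.\<close>
    case True
    have "Min ?A = 1"
    proof (rule Min_eqI[OF fin])
      have "1 < s \<Longrightarrow> n (s - 1) < n s" using n_less[of "s - 1" s] by simp
      then show "1 \<le> y" if "y \<in> ?A" for y using that True t by (auto split: if_splits)
      show "1 \<in> ?A" using t by simp
    qed
    then show ?thesis using True t by simp
  next
    case False
    then have "i < s \<or> j < s" using assms by auto
    then have "0 \<in> ?A" using t by (elim disjE) simp_all
    then have "Min ?A = 0" using Min_le[OF fin, of 0] by (simp only: le_zero_eq)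
    then show ?thesis using False t by auto
  qed
next
  case (Suc t')
  then show ?thesis by (simp only: upper_fun.simps(3))
qed

lemma
  assumes "i \<in> {1..s}" "j \<in> {1..s}"
  shows upper_fun_stay: "\<alpha> i j (Suc t) \<le> \<alpha> i j t + 1"
    and upper_fun_down_right: "1 < j \<Longrightarrow> \<alpha> i j (Suc t) \<le> n j - n (j - 1) + \<alpha> i (j - 1) t"
    and upper_fun_down_left: "1 < i \<Longrightarrow> \<alpha> i j (Suc t) \<le> n i - n (i - 1) + \<alpha> (i - 1) j t"
    and upper_fun_up_left: "i < s \<Longrightarrow> \<alpha> i j (Suc t) \<le> \<alpha> (Suc i) j t"
    and upper_fun_up_right: "j < s \<Longrightarrow> \<alpha> i j (Suc t) \<le> \<alpha> i (Suc j) t"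
  unfolding upper_fun_Suc[OF assms] by (rule Min_le; simp)+

lemma upper_fun_Suc_cases [consumes 2]:
  assumes "i \<in> {1..s}" "j \<in> {1..s}"
  obtains (stay) "\<alpha> i j (Suc t) = \<alpha> i j t + 1"
  | (down_right) k where "1 \<le> k" "j = Suc k" "\<alpha> i j (Suc t) = n j - n k + \<alpha> i k t"
  | (down_left) k where "1 \<le> k" "i = Suc k" "\<alpha> i j (Suc t) = n i - n k + \<alpha> k j t"
  | (up_left) "i < s" "\<alpha> i j (Suc t) = \<alpha> (Suc i) j t"
  | (up_right) "j < s" "\<alpha> i j (Suc t) = \<alpha> i (Suc j) t"
proof -
  let ?A = "{\<alpha> i j t + 1} \<union>
      (if 1 < j then {n j - n (j - 1) + \<alpha> i (j - 1) t} else {}) \<union>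
      (if 1 < i then {n i - n (i - 1) + \<alpha> (i - 1) j t} else {}) \<union>
      (if i < s then {\<alpha> (i + 1) j t} else {}) \<union>
      (if j < s then {\<alpha> i (j + 1) t} else {})"
  have "Min ?A \<in> ?A" by (rule Min_in) auto
  then have "\<alpha> i j (Suc t) \<in> ?A" by (simp only: upper_fun_Suc[OF assms])
  then show thesis
    using stay down_right[of "j - 1"] down_left[of "i - 1"] up_left up_right
    by (auto split: if_splits)
qed

text \<open>The steps of the two walks may be interleaved at will; the induction spends those of the
  left index first.\<close>

lemma upper_fun_le_convolution:
  assumes "i \<in> {1..s}" "j \<in> {1..s}"
  shows "\<alpha> i j (T + U) \<le> w i T + w j U"
  using assms
proof (induction "T + U" arbitrary: i j T U)
  case (Suc t)
  show ?case
  proof (cases T)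
    case T: (Suc T')
    then have t: "T' + U = t" using Suc by simp
    show ?thesis
    proof (cases rule: w_Suc_cases[of i T'])
      case stay
      then show ?thesis using T t Suc.hyps(1)[of T' U i j] upper_fun_stay[of i j t] Suc.prems
        by simp
    next
      case up
      then show ?thesis using T t Suc.hyps(1)[of T' U "Suc i" j] upper_fun_up_left[of i j t] Suc.prems
        by simp
    next
      case (down k)
      then show ?thesis using T t Suc.hyps(1)[of T' U k j] upper_fun_down_left[of i j t] Suc.prems
        by simp
    qed
  next
    case T: 0
    then obtain U' where U: "U = Suc U'" "U' = t" using Suc by simp
    show ?thesis
    proof (cases rule: w_Suc_cases[of j U'])
      case stay
      then show ?thesis using T U Suc.hyps(1)[of T U' i j] upper_fun_stay[of i j t] Suc.prems
        by simp
    next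
      case up
      then show ?thesis using T U Suc.hyps(1)[of T U' i "Suc j"] upper_fun_up_right[of j i t] Suc.prems
        upper_fun_up_right[of i j t]
        by simp
    next
      case (down k)
      then show ?thesis using T U Suc.hyps(1)[of T U' i k] upper_fun_down_right[of i j t] Suc.prems
        by simp
    qed
  qed
qed simp

text \<open>Each minimising option of the recursion is a step of one of the two walks. A stay could
  be charged to either; it is charged to the left one.\<close>

lemma upper_fun_convolution:
  assumes "i \<in> {1..s}" "j \<in> {1..s}"
  obtains T U where "T + U = t" "\<alpha> i j t = w i T + w j U"
proof -
  have "\<exists>T U. T + U = t \<and> w i T + w j U \<le> \<alpha> i j t"
    using assms
  proof (induction t arbitrary: i j)
    case (Suc t)
    from Suc.prems show ?case
    proof (cases rule: upper_fun_Suc_cases[where t = t])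
      case stay
      obtain T U where "T + U = t" "w i T + w j U \<le> \<alpha> i j t"
        using Suc by blast
      then show ?thesis using stay w_stay[of i T] by (intro exI[of _ "Suc T"] exI[of _ U]) simp
    next
      case (down_right k)
      then obtain T U where "T + U = t" "w i T + w k U \<le> \<alpha> i k t"
        using Suc.IH[of i k] Suc.prems by auto
      then show ?thesis using down_right w_down[of k U]
        by (intro exI[of _ T] exI[of _ "Suc U"]) simp
    next
      case (down_left k)
      then obtain T U where "T + U = t" "w k T + w j U \<le> \<alpha> k j t"
        using Suc.IH[of k j] Suc.prems by auto
      then show ?thesis using down_left w_down[of k T]
        by (intro exI[of _ "Suc T"] exI[of _ U]) simp
    next
      case up_left
      then obtain T U where "T + U = t" "w (Suc i) T + w j U \<le> \<alpha> (Suc i) j t"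
        using Suc.IH[of "Suc i" j] Suc.prems by auto
      then show ?thesis using up_left w_up[of i T]
        by (intro exI[of _ "Suc T"] exI[of _ U]) simp
    next
      case up_right
      then obtain T U where "T + U = t" "w i T + w (Suc j) U \<le> \<alpha> i (Suc j) t"
        using Suc.IH[of i "Suc j"] Suc.prems by auto
      then show ?thesis using up_right w_up[of j U]
        by (intro exI[of _ T] exI[of _ "Suc U"]) simp
    qed
  qed simp
  then show thesis
    using that upper_fun_le_convolution[OF assms] by (blast intro: order_antisym)
qed

lemma upper_fun_commute:
  assumes "i \<in> {1..s}" "j \<in> {1..s}"
  shows "\<alpha> i j t = \<alpha> j i t"
proof -
  have "\<alpha> i j t \<le> \<alpha> j i t" if ij: "i \<in> {1..s}" "j \<in> {1..s}" for i j
  proof -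
    obtain T U where "T + U = t" "\<alpha> j i t = w j T + w i U"
      using upper_fun_convolution[OF ij(2,1)] .
    then show ?thesis using upper_fun_le_convolution[OF ij, of U T] by (simp add: add.commute)
  qed
  then show ?thesis using assms by (simp add: order_antisym)
qed

text \<open>Exponent bookkeeping for one radical factor: its entries from level \<open>j\<close> to
  level \<open>k\<close> carry at least the power \<open>n k - n j\<close> of \<open>p\<close>, plus
  1 within a level. Only the second walk has to take a step for it.\<close>

lemma upper_fun_Suc_le:
  assumes "i \<in> {1..s}" "j \<in> {1..s}" "k \<in> {1..s}"
  shows "\<alpha> i k (Suc t) \<le> \<alpha> i j t + (n k - n j) + (if k = j then 1 else 0)"
proof -
  obtain T U where TU: "T + U = t" "\<alpha> i j t = w i T + w j U"
    using upper_fun_convolution[OF assms(1,2)] .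
  have "w k (Suc U) \<le> w j U + (n k - n j) + (if k = j then 1 else 0)"
    using w_stay[of k U] w_Suc_le_higher[of k j U] w_Suc_le_lower[of j k U] assms
    by (cases k j rule: linorder_cases) auto
  then show ?thesis
    using upper_fun_le_convolution[OF assms(1,3), of T "Suc U"] TU by simp
qed

lemma upper_fun_growth:
  assumes "i \<in> {1..s}" "j \<in> {1..s}"
  shows "t \<le> 2 * \<alpha> i j t + 2 * s"
proof -
  obtain T U where TU: "T + U = t" "\<alpha> i j t = w i T + w j U"
    using upper_fun_convolution[OF assms] .
  then show ?thesis using w_growth[of i T] w_growth[of j U] assms by auto
qed

text \<open>The excursion below level \<open>j\<close> that one coordinate makes before it steps up to \<open>j + 1\<close> can
  be made by the other coordinate instead, which also starts at \<open>j\<close>.\<close>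

lemma upper_fun_diagonal_crossing [consumes 2]:
  assumes "1 \<le> j" "j < s"
  obtains (trivial) "t = 0"
  | (crossing) T U where "T + U + 1 = t" "w (Suc j) T + w j U \<le> \<alpha> j j t"
proof (cases t)
  case (Suc t')
  have j: "j \<in> {1..s}" using assms by simp
  obtain T U where TU: "T + U = t" "\<alpha> j j t = w j T + w j U"
    using upper_fun_convolution[OF j j] .
  have *: "\<exists>T' U'. T' + U' + 1 = t \<and> w (Suc j) T' + w j U' \<le> \<alpha> j j t"
    if TU: "T + U = t" "\<alpha> j j t = w j T + w j U" and T: "T \<noteq> 0" for T U
  proof -
    obtain k c where "k < T" "w (Suc j) (T - 1 - k) + c \<le> w j T" "w j (k + U) \<le> c + w j U"
      using w_crossing[of j j T] assms T by auto
    then show ?thesis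
      using TU by (intro exI[of _ "T - 1 - k"] exI[of _ "k + U"]) auto
  qed
  have "\<exists>T' U'. T' + U' + 1 = t \<and> w (Suc j) T' + w j U' \<le> \<alpha> j j t"
  proof (cases "T = 0")
    case True
    then show ?thesis using *[of U T] TU Suc by (simp add: add.commute)
  qed (use *[of T U] TU in blast)
  then show thesis using crossing by blast
qed (use that in auto)

text \<open>By crossing, some optimal pair lets one walk begin with the free climb. A difference of
  diagonal entries at adjacent levels is controlled by \<open>\<alpha> j (Suc j) t\<close>, while
  the next stage asks for \<open>\<alpha> j j (Suc t)\<close>.\<close>

lemma upper_fun_diagonal_Suc:
  assumes "1 \<le> j" "j < s"
  shows "\<alpha> j j (Suc t) = \<alpha> j (Suc j) t"
proof -
  have j: "j \<in> {1..s}" "Suc j \<in> {1..s}" using assms by auto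
  obtain T U where "T + U = t" "w (Suc j) T + w j U \<le> \<alpha> j j (Suc t)"
    using upper_fun_diagonal_crossing[OF assms, of "Suc t"] by auto
  then have "\<alpha> j (Suc j) t \<le> \<alpha> j j (Suc t)"
    using upper_fun_le_convolution[OF j(2,1), of T U] upper_fun_commute[OF j, of t] by simp
  then show ?thesis using upper_fun_up_right[OF j(1,1), of t] assms by simp
qed

lemma upper_fun_diagonal_step:
  assumes "1 \<le> j" "j < s"
  shows "\<alpha> (Suc j) (Suc j) t \<le> \<alpha> j j t + (n (Suc j) - n j)"
  using assms
proof (cases rule: upper_fun_diagonal_crossing[where t = t])
  case trivial
  then show ?thesis by simp
next
  case (crossing T U)
  have "\<alpha> (Suc j) (Suc j) (T + Suc U) \<le> w (Suc j) T + w (Suc j) (Suc U)"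
    using assms by (intro upper_fun_le_convolution) auto
  then show ?thesis using crossing w_down[of j U] assms by simp
qed

text \<open>Hence the congruence demanded of a scalar at level \<open>s\<close> is the strongest one
  and implies those at all lower levels.\<close>

lemma upper_fun_diagonal_le:
  assumes "1 \<le> i" "i \<le> j" "j \<le> s"
  shows "n i - \<alpha> i i t \<le> n j - \<alpha> j j t"
  using assms(2,3)
proof (induction j rule: dec_induct)
  case (step j)
  then show ?case
    using upper_fun_diagonal_step[of j t] n_le[of j "Suc j"] assms by simp
qed simp

end

section \<open>Matrix rings over a chain of levels\<close>

lemma dvd_cong_iff:
  fixes a b m d :: int
  assumes "[a = b] (mod m)" "d dvd m"
  shows "d dvd a \<longleftrightarrow> d dvd b"
  using cong_dvd_modulus[OF assms] by (rule cong_dvd_iff)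

lemma power_dvd_mult_powerD:
  fixes q z :: int
  assumes "q \<noteq> 0" "q ^ m dvd z * q ^ d"
  shows "q ^ (m - d) dvd z"
proof (cases "d \<le> m")
  case True
  then have "q ^ m = q ^ (m - d) * q ^ d" by (simp flip: power_add)
  then show ?thesis using assms by simp
qed simp

lemma dvd_mult_cong_1:
  fixes c u q :: int
  assumes "Factorial_Ring.prime q" "[u = 1] (mod q)" "q ^ m dvd c * u"
  shows "q ^ m dvd c"
proof -
  have "\<not> q dvd u"
    using assms(1,2) cong_dvd_iff[OF assms(2)] not_prime_unit[of q] by auto
  then have "coprime (q ^ m) u"
    using prime_imp_coprime[OF assms(1)] by simp
  then show ?thesis using assms(3) coprime_dvd_mult_left_iff by blast
qed

text \<open>The entries are integer representatives, meaningful only modulo \<open>p ^ n j\<close> in the columns of level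
  \<open>j\<close>, and \<open>E x y g\<close> is the elementary matrix with the entry \<open>g\<close> at \<open>(x, y)\<close>.  About the product of
  two arbitrary matrices only divisibility is needed, which avoids sums over infinite bases.\<close>

locale matrix_ring = level_chain s n + ring R
  for s :: nat and n :: "nat \<Rightarrow> nat" and R :: "('a, 'm) ring_scheme" (structure) +
  fixes p :: nat
    and B :: "nat \<Rightarrow> 'b set"
    and ent :: "'a \<Rightarrow> nat \<times> 'b \<Rightarrow> nat \<times> 'b \<Rightarrow> int"
    and E :: "nat \<times> 'b \<Rightarrow> nat \<times> 'b \<Rightarrow> int \<Rightarrow> 'a"
  assumes p: "Factorial_Ring.prime p"
    and B_nonempty: "i \<in> {1..s} \<Longrightarrow> B i \<noteq> {}"
    and ent_add: "\<lbrakk>a \<in> carrier R; b \<in> carrier R; x \<in> Sigma {1..s} B; y \<in> Sigma {1..s} B\<rbrakk> \<Longrightarrow>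
      [ent (a \<oplus> b) x y = ent a x y + ent b x y] (mod int p ^ n (fst y))"
    and ent_one: "\<lbrakk>x \<in> Sigma {1..s} B; y \<in> Sigma {1..s} B\<rbrakk> \<Longrightarrow>
      [ent \<one> x y = (if x = y then 1 else 0)] (mod int p ^ n (fst y))"
    and ent_eqI: "\<lbrakk>a \<in> carrier R; b \<in> carrier R;
      \<And>x y. \<lbrakk>x \<in> Sigma {1..s} B; y \<in> Sigma {1..s} B\<rbrakk> \<Longrightarrow>
        [ent a x y = ent b x y] (mod int p ^ n (fst y))\<rbrakk> \<Longrightarrow> a = b"
    and ent_dvd: "\<lbrakk>a \<in> carrier R; x \<in> Sigma {1..s} B; y \<in> Sigma {1..s} B\<rbrakk> \<Longrightarrow>
      int p ^ (n (fst y) - n (fst x)) dvd ent a x y"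
    and ent_mult_dvd: "\<lbrakk>a \<in> carrier R; b \<in> carrier R; x \<in> Sigma {1..s} B; y \<in> Sigma {1..s} B;
      d dvd int p ^ n (fst y); \<And>z. z \<in> Sigma {1..s} B \<Longrightarrow> d dvd ent a x z * ent b z y\<rbrakk> \<Longrightarrow>
      d dvd ent (a \<otimes> b) x y"
    and E_closed: "\<lbrakk>x \<in> Sigma {1..s} B; y \<in> Sigma {1..s} B;
      int p ^ (n (fst y) - n (fst x)) dvd g\<rbrakk> \<Longrightarrow> E x y g \<in> carrier R"
    and ent_mult_E: "\<lbrakk>x \<in> Sigma {1..s} B; y \<in> Sigma {1..s} B;
      int p ^ (n (fst y) - n (fst x)) dvd g; a \<in> carrier R;
      z \<in> Sigma {1..s} B; v \<in> Sigma {1..s} B\<rbrakk> \<Longrightarrow>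
      [ent (a \<otimes> E x y g) z v = (if v = y then ent a z x * g else 0)] (mod int p ^ n (fst v))"
    and ent_E_mult: "\<lbrakk>x \<in> Sigma {1..s} B; y \<in> Sigma {1..s} B;
      int p ^ (n (fst y) - n (fst x)) dvd g; a \<in> carrier R;
      z \<in> Sigma {1..s} B; v \<in> Sigma {1..s} B\<rbrakk> \<Longrightarrow>
      [ent (E x y g \<otimes> a) z v = (if z = x then g * ent a y v else 0)] (mod int p ^ n (fst v))"
begin

abbreviation "Ix \<equiv> Sigma {1..s} B"
abbreviation "P k \<equiv> int p ^ k"
abbreviation smul :: "int \<Rightarrow> 'a \<Rightarrow> 'a" where "smul \<equiv> add_pow R"

lemma prime_P: "Factorial_Ring.prime (int p)" using p by simp

lemma p_pos [simp]: "0 < p" using p by (rule prime_gt_0_nat)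

lemma p_dvd_q: "x \<in> Ix \<Longrightarrow> int p dvd P (n (fst x))"
  using n_gt0[of "fst x"] by (intro dvd_power) auto

lemma ent_diff:
  assumes "a \<in> carrier R" "b \<in> carrier R" "x \<in> Ix" "y \<in> Ix"
  shows "[ent (a \<ominus> b) x y = ent a x y - ent b x y] (mod P (n (fst y)))"
proof -
  have "(a \<ominus> b) \<oplus> b = a" using assms by (simp add: minus_eq a_assoc l_neg)
  then have "[ent a x y = ent (a \<ominus> b) x y + ent b x y] (mod P (n (fst y)))"
    using ent_add[of "a \<ominus> b" b x y] assms by simp
  then show ?thesis by (simp add: cong_iff_dvd_diff algebra_simps dvd_diff_commute)
qed

lemma ent_zero:
  assumes "x \<in> Ix" "y \<in> Ix"
  shows "[ent \<zero> x y = 0] (mod P (n (fst y)))"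
  using ent_diff[of \<zero> \<zero> x y] assms by (simp add: minus_eq)

lemma ent_scalar:
  assumes "a \<in> carrier R" "x \<in> Ix" "y \<in> Ix"
  shows "[ent (smul c a) x y = c * ent a x y] (mod P (n (fst y)))"
proof (induction c rule: int_induct[where k = 0])
  case base
  have "smul 0 a = \<zero>" by (simp add: add_pow_def int_pow_def2)
  then show ?case using ent_zero assms by simp
next
  case (step1 c)
  have "smul (c + 1) a = smul c a \<oplus> a"
    using add.int_pow_mult[of a c 1] assms by simp
  then have "[ent (smul (c + 1) a) x y = ent (smul c a) x y + ent a x y] (mod P (n (fst y)))"
    using ent_add[of "smul c a" a x y] assms by simp
  also have "[ent (smul c a) x y + ent a x y = c * ent a x y + ent a x y] (mod P (n (fst y)))"
    using step1 by (intro cong_add) auto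
  finally show ?case by (simp add: algebra_simps)
next
  case (step2 c)
  have "smul (c - 1) a \<oplus> a = smul c a"
    using add.int_pow_mult[of a "c - 1" 1] assms by simp
  then have "[ent (smul c a) x y = ent (smul (c - 1) a) x y + ent a x y] (mod P (n (fst y)))"
    using ent_add[of "smul (c - 1) a" a x y] assms by simp
  then have "[ent (smul (c - 1) a) x y + ent a x y = c * ent a x y] (mod P (n (fst y)))"
    using step2 by (metis cong_sym cong_trans)
  then show ?case by (simp add: cong_iff_dvd_diff algebra_simps)
qed

lemma ent_scalar_one:
  assumes "x \<in> Ix" "y \<in> Ix"
  shows "[ent (smul c \<one>) x y = (if x = y then c else 0)] (mod P (n (fst y)))"
  using cong_trans[OF ent_scalar[of \<one> x y c] cong_mult[OF cong_refl ent_one[OF assms]]] assms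
  by (simp split: if_splits)

lemma ent_E:
  assumes "x \<in> Ix" "y \<in> Ix" "P (n (fst y) - n (fst x)) dvd g" "z \<in> Ix" "v \<in> Ix"
  shows "[ent (E x y g) z v = (if z = x \<and> v = y then g else 0)] (mod P (n (fst v)))"
proof -
  have E: "E x y g \<in> carrier R" using E_closed assms by simp
  have "[ent (E x y g) z v = (if z = x then g * ent \<one> y v else 0)] (mod P (n (fst v)))"
    using ent_E_mult[OF assms(1-3) one_closed assms(4,5)] E by simp
  also have "[(if z = x then g * ent \<one> y v else 0) = (if z = x then g * (if y = v then 1 else 0) else 0)]
      (mod P (n (fst v)))"
    using cong_mult[OF cong_refl ent_one[OF assms(2,5)], of g] by simp
  finally show ?thesis by (simp add: eq_commute split: if_splits)
qed

section \<open>Entrywise descriptions of the radical and the annihilating sequence\<close>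

definition rad :: "'a set" where
  "rad = {a \<in> carrier R. \<forall>x\<in>Ix. \<forall>y\<in>Ix. fst x = fst y \<longrightarrow> int p dvd ent a x y}"

text \<open>At \<open>t = 0\<close> the dummy value 0 of \<alpha> leaves the full modulus, so the
  family starts at zero; once \<alpha> reaches \<open>n (fst y)\<close> the condition is
  void.\<close>

definition ann :: "nat \<Rightarrow> 'a set" where
  "ann t = {a \<in> rad. \<forall>x\<in>Ix. \<forall>y\<in>Ix. P (n (fst y) - \<alpha> (fst x) (fst y) t) dvd ent a x y}"

lemma rad_closed [simp]: "a \<in> rad \<Longrightarrow> a \<in> carrier R"
  by (simp add: rad_def)

lemma ann_rad: "a \<in> ann t \<Longrightarrow> a \<in> rad"
  by (simp add: ann_def)

lemma ann_closed [simp]: "a \<in> ann t \<Longrightarrow> a \<in> carrier R"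
  by (rule rad_closed[OF ann_rad])

lemma radD: "\<lbrakk>a \<in> rad; x \<in> Ix; y \<in> Ix; fst x = fst y\<rbrakk> \<Longrightarrow> int p dvd ent a x y"
  unfolding rad_def by blast

lemma annD: "\<lbrakk>a \<in> ann t; x \<in> Ix; y \<in> Ix\<rbrakk> \<Longrightarrow> P (n (fst y) - \<alpha> (fst x) (fst y) t) dvd ent a x y"
  unfolding ann_def by blast

lemma radI:
  "\<lbrakk>a \<in> carrier R; \<And>x y. \<lbrakk>x \<in> Ix; y \<in> Ix; fst x = fst y\<rbrakk> \<Longrightarrow> int p dvd ent a x y\<rbrakk> \<Longrightarrow> a \<in> rad"
  unfolding rad_def by blast

lemma annI:
  "\<lbrakk>a \<in> rad; \<And>x y. \<lbrakk>x \<in> Ix; y \<in> Ix\<rbrakk> \<Longrightarrow> P (n (fst y) - \<alpha> (fst x) (fst y) t) dvd ent a x y\<rbrakk>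
    \<Longrightarrow> a \<in> ann t"
  unfolding ann_def by blast

lemma P_diff_dvd: "P (n j - k) dvd P (n j)"
  by (simp add: le_imp_power_dvd)

lemma dvd_add_ent:
  assumes "a \<in> carrier R" "b \<in> carrier R" "x \<in> Ix" "y \<in> Ix" "d dvd P (n (fst y))"
    "d dvd ent a x y" "d dvd ent b x y"
  shows "d dvd ent (a \<oplus> b) x y"
  using dvd_cong_iff[OF ent_add[OF assms(1-4)] assms(5)] assms(6,7) by simp

lemma dvd_diff_ent:
  assumes "a \<in> carrier R" "b \<in> carrier R" "x \<in> Ix" "y \<in> Ix" "d dvd P (n (fst y))"
    "d dvd ent a x y" "d dvd ent b x y"
  shows "d dvd ent (a \<ominus> b) x y"
  using dvd_cong_iff[OF ent_diff[OF assms(1-4)] assms(5)] assms(6,7) by simp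

lemma rad_add: "a \<in> rad \<Longrightarrow> b \<in> rad \<Longrightarrow> a \<oplus> b \<in> rad"
  by (rule radI) (simp_all add: dvd_add_ent p_dvd_q radD del: mem_Sigma_iff)

lemma rad_diff: "a \<in> rad \<Longrightarrow> b \<in> rad \<Longrightarrow> a \<ominus> b \<in> rad"
  by (rule radI) (simp_all add: dvd_diff_ent p_dvd_q radD del: mem_Sigma_iff)

lemma ann_add: "a \<in> ann t \<Longrightarrow> b \<in> ann t \<Longrightarrow> a \<oplus> b \<in> ann t"
  by (rule annI[OF rad_add[OF ann_rad ann_rad]])
    (assumption | rule dvd_add_ent ann_closed P_diff_dvd annD)+

lemma ann_diff: "a \<in> ann t \<Longrightarrow> b \<in> ann t \<Longrightarrow> a \<ominus> b \<in> ann t"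
  by (rule annI[OF rad_diff[OF ann_rad ann_rad]])
    (assumption | rule dvd_diff_ent ann_closed P_diff_dvd annD)+

lemma zero_in_rad [simp]: "\<zero> \<in> rad"
proof (rule radI)
  fix x y assume xy: "x \<in> Ix" "y \<in> Ix"
  show "int p dvd ent \<zero> x y"
    using dvd_cong_iff[OF ent_zero[OF xy] p_dvd_q[OF xy(2)]] by simp
qed simp

lemma zero_in_ann [simp]: "\<zero> \<in> ann t"
proof (rule annI)
  fix x y assume xy: "x \<in> Ix" "y \<in> Ix"
  show "P (n (fst y) - \<alpha> (fst x) (fst y) t) dvd ent \<zero> x y"
    using dvd_cong_iff[OF ent_zero[OF xy] P_diff_dvd] by simp
qed simp

lemma p_dvd_ent_off_level:
  assumes "a \<in> carrier R" "x \<in> Ix" "y \<in> Ix" "fst x < fst y"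
  shows "int p dvd ent a x y"
proof -
  have "n (fst x) < n (fst y)" using assms n_less[of "fst x" "fst y"] by auto
  then have "int p dvd P (n (fst y) - n (fst x))" by (intro dvd_power) auto
  then show ?thesis using ent_dvd[OF assms(1-3)] dvd_trans by blast
qed

text \<open>For \<open>x\<close> and \<open>y\<close> on one level, the path from \<open>x\<close>
  over \<open>z\<close> to \<open>y\<close> either climbs on one of its two legs, where
  \<open>p\<close> divides every entry, or stays on the level, where the radical factor supplies
  \<open>p\<close>.\<close>

lemma rad_mult:
  assumes "a \<in> rad" "b \<in> carrier R"
  shows rad_mult_right: "a \<otimes> b \<in> rad" and rad_mult_left: "b \<otimes> a \<in> rad"
proof -
  have a: "int p dvd ent a x z" if "x \<in> Ix" "z \<in> Ix" "fst x \<le> fst z" for x z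
    using that assms p_dvd_ent_off_level[of a x z] radD[of a x z] by (cases "fst x = fst z") auto
  have b: "int p dvd ent b x z" if "x \<in> Ix" "z \<in> Ix" "fst x < fst z" for x z
    using that assms p_dvd_ent_off_level[of b x z] by blast
  show "a \<otimes> b \<in> rad"
  proof (rule radI)
    fix x y assume xy: "x \<in> Ix" "y \<in> Ix" "fst x = fst y"
    have "int p dvd ent a x z * ent b z y" if "z \<in> Ix" for z
      using a[of x z] b[of z y] xy that by (cases "fst x \<le> fst z") (simp_all del: mem_Sigma_iff)
    then show "int p dvd ent (a \<otimes> b) x y"
      using ent_mult_dvd[of a b x y "int p"] assms xy p_dvd_q by (simp del: mem_Sigma_iff)
  qed (use assms in simp)
  show "b \<otimes> a \<in> rad"
  proof (rule radI)
    fix x y assume xy: "x \<in> Ix" "y \<in> Ix" "fst x = fst y"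
    have "int p dvd ent b x z * ent a z y" if "z \<in> Ix" for z
      using b[of x z] a[of z y] xy that by (cases "fst x < fst z") (simp_all del: mem_Sigma_iff)
    then show "int p dvd ent (b \<otimes> a) x y"
      using ent_mult_dvd[of b a x y "int p"] assms xy p_dvd_q by (simp del: mem_Sigma_iff)
  qed (use assms in simp)
qed

text \<open>The generator of the entries that \<open>rad\<close> admits at \<open>(x, y)\<close>:
  the power of \<open>p\<close> forced by the orders of the two basis elements, and one extra
  \<open>p\<close> within a level.\<close>

definition unit_entry :: "nat \<times> 'b \<Rightarrow> nat \<times> 'b \<Rightarrow> int" where
  "unit_entry x y = P (n (fst y) - n (fst x)) * (if fst x = fst y then int p else 1)"

abbreviation "F x y \<equiv> E x y (unit_entry x y)"

lemma unit_entry_dvd: "P (n (fst y) - n (fst x)) dvd unit_entry x y"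
  by (simp add: unit_entry_def)

lemma F_rad:
  assumes "x \<in> Ix" "y \<in> Ix"
  shows "F x y \<in> rad"
proof (rule radI)
  fix z v assume zv: "z \<in> Ix" "v \<in> Ix" "fst z = fst v"
  then show "int p dvd ent (F x y) z v"
    using dvd_cong_iff[OF ent_E[OF assms unit_entry_dvd zv(1,2)] p_dvd_q[OF zv(2)]]
    by (auto simp: unit_entry_def)
qed (use assms E_closed unit_entry_dvd in simp)

text \<open>The recursion of \<alpha> moves one index by at most one level, so these pairs suffice
  as tests. The restriction also puts the partner of a lone top basis element at level
  \<open>s - 1\<close>.\<close>

definition adj :: "nat \<times> 'b \<Rightarrow> nat \<times> 'b \<Rightarrow> bool" where
  "adj x y \<longleftrightarrow> fst x = fst y \<or> fst y = Suc (fst x) \<or> fst x = Suc (fst y)"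

text \<open>Right (left) multiplication by the elementary matrices \<open>F y v\<close> (\<open>F v x\<close>) turns the entry \<open>c\<close>
  at \<open>(x, y)\<close> into \<open>c\<close> times their nonzero entry; this is where the recursion for \<open>\<alpha>\<close> comes from.\<close>

lemma dvd_entry_Suc:
  assumes x: "x \<in> Ix" and y: "y \<in> Ix"
    and right: "\<And>v. v \<in> Ix \<Longrightarrow> adj y v \<Longrightarrow>
      P (n (fst v) - \<alpha> (fst x) (fst v) t) dvd c * unit_entry y v"
    and left: "\<And>v. v \<in> Ix \<Longrightarrow> adj v x \<Longrightarrow>
      P (n (fst y) - \<alpha> (fst v) (fst y) t) dvd unit_entry v x * c"
  shows "P (n (fst y) - \<alpha> (fst x) (fst y) (Suc t)) dvd c"
proof -
  have lev: "fst x \<in> {1..s}" "fst y \<in> {1..s}" using x y by auto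
  have ex: "\<exists>v\<in>Ix. fst v = i" if "i \<in> {1..s}" for i
    using B_nonempty[OF that] that by force
  from lev show ?thesis
  proof (cases rule: upper_fun_Suc_cases[where t = t])
    case stay
    then show ?thesis
      using right[OF y] power_dvd_mult_powerD[of "int p" "n (fst y) - \<alpha> (fst x) (fst y) t" c 1] by (simp add: adj_def unit_entry_def)
  next
    case (down_right k)
    obtain v where v: "v \<in> Ix" "fst v = k" using ex[of k] down_right lev by auto
    have "n k < n (fst y)" using down_right lev n_less[of k "fst y"] by simp
    then show ?thesis
      using right[OF v(1)] v down_right by (simp add: adj_def unit_entry_def)
  next
    case (down_left k)
    obtain v where v: "v \<in> Ix" "fst v = k" using ex[of k] down_left lev by auto
    then show ?thesis
      using left[OF v(1)] v down_left
        power_dvd_mult_powerD[of "int p" "n (fst y) - \<alpha> k (fst y) t" c "n (fst x) - n k"]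
      by (simp add: adj_def unit_entry_def mult.commute add.commute)
  next
    case up_left
    obtain v where v: "v \<in> Ix" "fst v = Suc (fst x)" using ex[of "Suc (fst x)"] up_left lev by auto
    have "n (fst x) < n (Suc (fst x))" using up_left lev n_less[of "fst x" "Suc (fst x)"] by simp
    then show ?thesis
      using left[OF v(1)] v up_left by (simp add: adj_def unit_entry_def)
  next
    case up_right
    obtain v where v: "v \<in> Ix" "fst v = Suc (fst y)" using ex[of "Suc (fst y)"] up_right lev by auto
    have "n (fst y) < n (Suc (fst y))" using up_right lev n_less[of "fst y" "Suc (fst y)"] by simp
    then show ?thesis
      using right[OF v(1)] v up_right
        power_dvd_mult_powerD[of "int p" "n (fst v) - \<alpha> (fst x) (fst v) t" c "n (fst v) - n (fst y)"]
      by (simp add: adj_def unit_entry_def)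
  qed
qed

text \<open>The exponents of the two factors add up. Since \<open>z\<close> may lie on any level,
  \<open>upper_fun_Suc_le\<close> is needed for arbitrary jumps; the second claim uses it for the
  left index, through the symmetry of \<alpha>.\<close>

lemma dvd_product_entries:
  assumes "a \<in> ann (Suc t)" "b \<in> rad" "x \<in> Ix" "y \<in> Ix" "z \<in> Ix"
  shows "P (n (fst y) - \<alpha> (fst x) (fst y) t) dvd ent a x z * ent b z y"
    and "P (n (fst y) - \<alpha> (fst x) (fst y) t) dvd ent b x z * ent a z y"
proof -
  have lev: "fst x \<in> {1..s}" "fst y \<in> {1..s}" "fst z \<in> {1..s}" using assms by auto
  let ?e = "\<lambda>i j. if i = j then 1 else 0 :: nat"
  have b: "P ((n (fst v) - n (fst u)) + ?e (fst u) (fst v)) dvd ent b u v"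
    if "u \<in> Ix" "v \<in> Ix" for u v
    using that assms radD[of b u v] ent_dvd[of b u v] by (cases "fst u = fst v") auto
  have le: "n k - n j \<le> n i - n j + (n k - n i)" for i j k by simp
  have "n (fst y) - \<alpha> (fst x) (fst y) t \<le>
      (n (fst z) - \<alpha> (fst x) (fst z) (Suc t)) + ((n (fst y) - n (fst z)) + ?e (fst z) (fst y))"
    using upper_fun_Suc_le[OF lev(1,2,3), of t] by auto
  then have "P (n (fst y) - \<alpha> (fst x) (fst y) t) dvd
      P (n (fst z) - \<alpha> (fst x) (fst z) (Suc t)) * P ((n (fst y) - n (fst z)) + ?e (fst z) (fst y))"
    unfolding power_add[symmetric] by (rule le_imp_power_dvd)
  also have "\<dots> dvd ent a x z * ent b z y"
    using assms by (intro mult_dvd_mono annD b)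
  finally show "P (n (fst y) - \<alpha> (fst x) (fst y) t) dvd ent a x z * ent b z y" .
  have "\<alpha> (fst z) (fst y) (Suc t) \<le> \<alpha> (fst x) (fst y) t + (n (fst z) - n (fst x)) + ?e (fst z) (fst x)"
    using upper_fun_Suc_le[OF lev(2,1,3), of t] upper_fun_commute[OF lev(3,2)]
      upper_fun_commute[OF lev(1,2)] by simp
  then have "n (fst y) - \<alpha> (fst x) (fst y) t \<le>
      ((n (fst z) - n (fst x)) + ?e (fst x) (fst z)) + (n (fst y) - \<alpha> (fst z) (fst y) (Suc t))"
    by (auto split: if_splits)
  then have "P (n (fst y) - \<alpha> (fst x) (fst y) t) dvd
      P ((n (fst z) - n (fst x)) + ?e (fst x) (fst z)) * P (n (fst y) - \<alpha> (fst z) (fst y) (Suc t))"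
    unfolding power_add[symmetric] by (rule le_imp_power_dvd)
  also have "\<dots> dvd ent b x z * ent a z y"
    using assms by (intro mult_dvd_mono annD b)
  finally show "P (n (fst y) - \<alpha> (fst x) (fst y) t) dvd ent b x z * ent a z y" .
qed

lemma ann_Suc: "ann (Suc t) = {a \<in> rad. \<forall>b\<in>rad. a \<otimes> b \<in> ann t \<and> b \<otimes> a \<in> ann t}"
proof (rule Set.set_eqI, rule iffI)
  fix a assume a: "a \<in> ann (Suc t)"
  have "a \<otimes> b \<in> ann t \<and> b \<otimes> a \<in> ann t" if b: "b \<in> rad" for b
  proof -
    have "P (n (fst y) - \<alpha> (fst x) (fst y) t) dvd ent (a \<otimes> b) x y"
      "P (n (fst y) - \<alpha> (fst x) (fst y) t) dvd ent (b \<otimes> a) x y" if "x \<in> Ix" "y \<in> Ix" for x y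
      using a b that by (intro ent_mult_dvd P_diff_dvd dvd_product_entries; simp add: ann_rad del: mem_Sigma_iff)+
    then show ?thesis
      using rad_mult[OF b ann_closed[OF a]] by (blast intro: annI)
  qed
  then show "a \<in> {a \<in> rad. \<forall>b\<in>rad. a \<otimes> b \<in> ann t \<and> b \<otimes> a \<in> ann t}"
    using ann_rad[OF a] by blast
next
  fix a assume "a \<in> {a \<in> rad. \<forall>b\<in>rad. a \<otimes> b \<in> ann t \<and> b \<otimes> a \<in> ann t}"
  then have a: "a \<in> rad" and *: "\<forall>b\<in>rad. a \<otimes> b \<in> ann t \<and> b \<otimes> a \<in> ann t" by auto
  have "P (n (fst y) - \<alpha> (fst x) (fst y) (Suc t)) dvd ent a x y" if x: "x \<in> Ix" and y: "y \<in> Ix" for x y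
  proof (rule dvd_entry_Suc[OF x y])
    fix v assume v: "v \<in> Ix"
    have "P (n (fst v) - \<alpha> (fst x) (fst v) t) dvd ent (a \<otimes> F y v) x v"
      using * F_rad[OF y v] annD x v by blast
    then show "P (n (fst v) - \<alpha> (fst x) (fst v) t) dvd ent a x y * unit_entry y v"
      using dvd_cong_iff[OF ent_mult_E[OF y v unit_entry_dvd rad_closed[OF a] x v] P_diff_dvd] by simp
  next
    fix v assume v: "v \<in> Ix"
    have "P (n (fst y) - \<alpha> (fst v) (fst y) t) dvd ent (F v x \<otimes> a) v y"
      using * F_rad[OF v x] annD y v by blast
    then show "P (n (fst y) - \<alpha> (fst v) (fst y) t) dvd unit_entry v x * ent a x y"
      using dvd_cong_iff[OF ent_E_mult[OF v x unit_entry_dvd rad_closed[OF a] v y] P_diff_dvd] by simp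
  qed
  then show "a \<in> ann (Suc t)" by (rule annI[OF a])
qed

lemma ann_0: "ann 0 = {\<zero>}"
proof -
  have "a = \<zero>" if a: "a \<in> ann 0" for a
  proof (rule ent_eqI)
    fix x y assume xy: "x \<in> Ix" "y \<in> Ix"
    have "[ent a x y = 0] (mod P (n (fst y)))"
      using annD[OF a xy] by (simp add: cong_0_iff)
    then show "[ent a x y = ent \<zero> x y] (mod P (n (fst y)))"
      using ent_zero[OF xy] by (metis cong_sym cong_trans)
  qed (use a in simp_all)
  then show ?thesis by auto
qed

text \<open>A formal consequence of \<open>ann_Suc\<close>. Both sides go through the induction
  together: \<open>c \<otimes> (a \<otimes> b)\<close> is \<open>(c \<otimes> a) \<otimes> b\<close>
  with \<open>c \<otimes> a\<close> one index lower, while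
  \<open>(a \<otimes> b) \<otimes> c\<close> only uses that \<open>b \<otimes> c\<close> is in
  \<open>rad\<close>.\<close>

lemma ann_mult_right:
  assumes "a \<in> ann t" "b \<in> carrier R"
  shows "a \<otimes> b \<in> ann t"
proof -
  have "a \<otimes> b \<in> ann t \<and> b \<otimes> a \<in> ann t"
    using assms
  proof (induction t arbitrary: a b)
    case 0
    then show ?case by (simp add: ann_0)
  next
    case (Suc t)
    then have a: "a \<in> rad" and *: "\<And>c. c \<in> rad \<Longrightarrow> a \<otimes> c \<in> ann t \<and> c \<otimes> a \<in> ann t"
      by (auto simp: ann_Suc)
    have "(a \<otimes> b) \<otimes> c \<in> ann t \<and> c \<otimes> (a \<otimes> b) \<in> ann t \<and> (b \<otimes> a) \<otimes> c \<in> ann t \<and> c \<otimes> (b \<otimes> a) \<in> ann t"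
      if c: "c \<in> rad" for c
    proof (intro conjI)
      have cl: "a \<in> carrier R" "b \<in> carrier R" "c \<in> carrier R" using a c Suc.prems by auto
      show "(a \<otimes> b) \<otimes> c \<in> ann t"
        using *[OF rad_mult_left[OF c cl(2)]] m_assoc[OF cl] by simp
      show "c \<otimes> (a \<otimes> b) \<in> ann t"
        using Suc.IH[of "c \<otimes> a" b] *[OF c] m_assoc[OF cl(3,1,2)] cl by simp
      show "(b \<otimes> a) \<otimes> c \<in> ann t"
        using Suc.IH[of "a \<otimes> c" b] *[OF c] m_assoc[OF cl(2,1,3)] cl by simp
      show "c \<otimes> (b \<otimes> a) \<in> ann t"
        using *[OF rad_mult_right[OF c cl(2)]] m_assoc[OF cl(3,2,1)] by simp
    qed
    then show ?case
      using rad_mult[OF a Suc.prems(2)] by (auto simp: ann_Suc)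
  qed
  then show ?thesis by simp
qed

text \<open>The index comes from \<open>upper_fun_growth\<close>, which there forces \<alpha> to be
  at least \<open>n s\<close>, so no congruence is left. Together with \<open>ann_0\<close> and
  \<open>ann_Suc\<close> this is the nilpotency of \<open>rad\<close>.\<close>

lemma ann_eq_rad: "ann (2 * n s + 2 * s) = rad"
proof -
  have "n j \<le> \<alpha> i j (2 * n s + 2 * s)" if "i \<in> {1..s}" "j \<in> {1..s}" for i j
    using upper_fun_growth[OF that, of "2 * n s + 2 * s"] n_le[of j s] that by auto
  then have "n (fst y) - \<alpha> (fst x) (fst y) (2 * n s + 2 * s) = 0" if "x \<in> Ix" "y \<in> Ix" for x y
    using that by auto
  then have "a \<in> ann (2 * n s + 2 * s)" if "a \<in> rad" for a
    by (intro annI[OF that]) simp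
  then show ?thesis using ann_rad by blast
qed

end

section \<open>The Jacobson radical and the group \<open>1 + J\<close>\<close>

lemma (in ring) add_diff_cancel_right:
  assumes "u \<in> carrier R" "v \<in> carrier R" "w \<in> carrier R"
  shows "(u \<oplus> v) \<ominus> (w \<oplus> v) = u \<ominus> w"
proof -
  have "(u \<oplus> v) \<ominus> (w \<oplus> v) = u \<oplus> (v \<oplus> (\<ominus> v \<oplus> \<ominus> w))"
    using assms by (simp add: minus_eq minus_add a_assoc a_comm[of "\<ominus> w"])
  also have "v \<oplus> (\<ominus> v \<oplus> \<ominus> w) = \<ominus> w" using assms by (simp add: r_neg2)
  finally show ?thesis by (simp add: minus_eq)
qed

lemma (in ring) diff_add_cancel:
  assumes "u \<in> carrier R" "v \<in> carrier R"
  shows "(u \<ominus> v) \<oplus> v = u"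
  using assms by (simp add: minus_eq a_assoc l_neg)

lemma (in ring) one_plus_mult:
  assumes "a \<in> carrier R" "b \<in> carrier R"
  shows "(a \<oplus> \<one>) \<otimes> (b \<oplus> \<one>) = a \<otimes> b \<oplus> (a \<oplus> b \<oplus> \<one>)"
  using assms by (simp add: l_distr r_distr a_ac)

lemma (in ring) additive_subgroup_diffI:
  assumes "H \<subseteq> carrier R" "\<zero> \<in> H" "\<And>a b. a \<in> H \<Longrightarrow> b \<in> H \<Longrightarrow> a \<ominus> b \<in> H"
  shows "additive_subgroup H R"
proof -
  have neg: "\<ominus> a \<in> H" if "a \<in> H" for a
    using assms(3)[OF assms(2) that] assms(1) that by (simp add: minus_eq subset_iff)
  have "a \<oplus> b \<in> H" if "a \<in> H" "b \<in> H" for a b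
    using assms(3)[OF that(1) neg[OF that(2)]] assms(1) that by (simp add: minus_eq subset_iff)
  then show ?thesis
    using assms neg by (intro additive_subgroupI add.subgroupI) auto
qed

context matrix_ring
begin

lemma ann_uminus: "a \<in> ann t \<Longrightarrow> \<ominus> a \<in> ann t"
  using ann_diff[OF zero_in_ann, of a t] by (simp add: minus_eq)

lemma rad_uminus: "a \<in> rad \<Longrightarrow> \<ominus> a \<in> rad"
  using rad_diff[OF zero_in_rad, of a] by (simp add: minus_eq)

text \<open>In place of a geometric series, \<open>(1 + a) (1 - a) = 1 - a a\<close> lowers the
  index, because the square of an element of \<open>ann (Suc t)\<close> lies in
  \<open>ann t\<close>.\<close>

lemma one_plus_right_inverse:
  assumes "a \<in> ann t"
  obtains b where "b \<in> rad" "(a \<oplus> \<one>) \<otimes> (b \<oplus> \<one>) = \<one>"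
proof -
  have "\<exists>b\<in>rad. (a \<oplus> \<one>) \<otimes> (b \<oplus> \<one>) = \<one>"
    using assms
  proof (induction t arbitrary: a)
    case 0
    then show ?case by (intro bexI[of _ \<zero>]) (simp_all add: ann_0)
  next
    case (Suc t)
    then have a: "a \<in> rad" "a \<in> carrier R" by (simp_all add: ann_rad)
    then have "\<ominus> (a \<otimes> a) \<in> ann t" using Suc.prems by (intro ann_uminus) (simp add: ann_Suc)
    then obtain b where b: "b \<in> rad" "(\<ominus> (a \<otimes> a) \<oplus> \<one>) \<otimes> (b \<oplus> \<one>) = \<one>"
      using Suc.IH by blast
    have bc: "b \<in> carrier R" using b by simp
    have "(a \<oplus> \<one>) \<otimes> (\<ominus> a \<oplus> \<one>) = \<ominus> (a \<otimes> a) \<oplus> \<one>"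
      using a by (simp add: one_plus_mult r_minus r_neg)
    then have "\<one> = (a \<oplus> \<one>) \<otimes> ((\<ominus> a \<oplus> \<one>) \<otimes> (b \<oplus> \<one>))"
      using b(2) a bc by (simp flip: m_assoc)
    also have "(\<ominus> a \<oplus> \<one>) \<otimes> (b \<oplus> \<one>) = (\<ominus> a \<otimes> b \<oplus> (\<ominus> a \<oplus> b)) \<oplus> \<one>"
      using a bc by (simp add: one_plus_mult a_assoc)
    finally show ?case
      using a b(1) by (intro bexI[of _ "\<ominus> a \<otimes> b \<oplus> (\<ominus> a \<oplus> b)"])
        (auto intro!: rad_add rad_mult_right rad_uminus)
  qed
  then show thesis using that by blast
qed

text \<open>The right inverse has a right inverse of its own, which must be
  \<open>a \<oplus> \<one>\<close>.\<close>

lemma one_plus_inverse: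
  assumes "a \<in> rad"
  obtains b where "b \<in> rad" "(a \<oplus> \<one>) \<otimes> (b \<oplus> \<one>) = \<one>" "(b \<oplus> \<one>) \<otimes> (a \<oplus> \<one>) = \<one>"
proof -
  obtain b where b: "b \<in> rad" "(a \<oplus> \<one>) \<otimes> (b \<oplus> \<one>) = \<one>"
    using one_plus_right_inverse assms unfolding ann_eq_rad[symmetric] by blast
  obtain c where c: "c \<in> rad" "(b \<oplus> \<one>) \<otimes> (c \<oplus> \<one>) = \<one>"
    using one_plus_right_inverse b(1) unfolding ann_eq_rad[symmetric] by blast
  have "a \<oplus> \<one> = (a \<oplus> \<one>) \<otimes> ((b \<oplus> \<one>) \<otimes> (c \<oplus> \<one>))" using c(2) assms by simp
  also have "\<dots> = c \<oplus> \<one>" using assms b c(1) by (simp flip: m_assoc)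
  finally show thesis using that b c by simp
qed

lemma rad_additive_subgroup: "additive_subgroup rad R"
  by (rule additive_subgroup_diffI) (auto intro: rad_diff)

lemma jacobson_radical_eq_rad: "jacobson_radical R = rad"
proof
  show "rad \<subseteq> jacobson_radical R"
  proof
    fix a assume a: "a \<in> rad"
    have "a \<in> M" if M: "maximal_left_ideal M R" for M
    proof (rule ccontr)
      assume "a \<notin> M"
      have Mlin: "additive_subgroup M R" "\<And>x m. x \<in> carrier R \<Longrightarrow> m \<in> M \<Longrightarrow> x \<otimes> m \<in> M"
        and MR: "M \<noteq> carrier R"
        and Mmax: "\<And>I. left_ideal I R \<Longrightarrow> M \<subseteq> I \<Longrightarrow> I = M \<or> I = carrier R"
        using M unfolding maximal_left_ideal_def left_ideal_def by blast+
      interpret M: additive_subgroup M R by (rule Mlin(1))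
      have "left_ideal (set_add R rad M) R"
        unfolding left_ideal_def
      proof (intro conjI ballI)
        show "additive_subgroup (set_add R rad M) R"
          by (rule add_additive_subgroups[OF rad_additive_subgroup Mlin(1)])
        fix x y assume x: "x \<in> carrier R" and "y \<in> set_add R rad M"
        then obtain u m where um: "u \<in> rad" "m \<in> M" "y = u \<oplus> m" by (auto simp: set_add_def')
        then have "x \<otimes> y = x \<otimes> u \<oplus> x \<otimes> m" using x by (simp add: r_distr)
        then show "x \<otimes> y \<in> set_add R rad M"
          using um(3) rad_mult_left[OF um(1) x] Mlin(2)[OF x um(2)] unfolding set_add_def' by blast
      qed
      moreover have "M \<subseteq> set_add R rad M"
      proof
        fix m assume m: "m \<in> M"
        then have "m = \<zero> \<oplus> m" by simp
        then show "m \<in> set_add R rad M" using m zero_in_rad unfolding set_add_def' by blast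
      qed
      moreover have "a = a \<oplus> \<zero>" using a by simp
      then have "a \<in> set_add R rad M" using a M.zero_closed unfolding set_add_def' by blast
      ultimately have "set_add R rad M = carrier R" using Mmax \<open>a \<notin> M\<close> by blast
      then have "\<one> \<in> set_add R rad M" by simp
      then obtain u m where um: "u \<in> rad" "m \<in> M" "\<one> = u \<oplus> m" by (auto simp: set_add_def')
      have "m = \<ominus> u \<oplus> \<one>" using um by (simp add: r_neg1)
      then obtain b where "b \<in> rad" "(b \<oplus> \<one>) \<otimes> m = \<one>"
        using one_plus_inverse[OF rad_uminus[OF um(1)]] by metis
      then have one: "\<one> \<in> M" using Mlin(2)[of "b \<oplus> \<one>" m] um(2) by simp
      have "x \<in> M" if "x \<in> carrier R" for x using Mlin(2)[OF that one] that by simp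
      then show False using MR M.a_subset by blast
    qed
    then show "a \<in> jacobson_radical R" using a by (simp add: jacobson_radical_def)
  qed
  show "jacobson_radical R \<subseteq> rad"
  proof
    fix a assume a: "a \<in> jacobson_radical R"
    show "a \<in> rad"
    proof (rule radI)
      fix x y assume xy: "x \<in> Ix" "y \<in> Ix" "fst x = fst y"
      \<comment> \<open>Modulo \<open>p\<close> the level of \<open>y\<close> becomes a vector
        space, and \<open>M\<close> consists of the maps whose coordinate \<open>y\<close> vanishes
        on it. It is maximal because precomposition turns any nonzero functional into the coordinate
        \<open>y\<close>.\<close>
      define M where "M = {b \<in> carrier R. \<forall>z. z \<in> Ix \<and> fst z = fst y \<longrightarrow> int p dvd ent b z y}"
      have Msub: "additive_subgroup M R"
      proof (rule additive_subgroup_diffI)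
        show "b \<ominus> c \<in> M" if "b \<in> M" "c \<in> M" for b c
          using that xy p_dvd_q[OF xy(2)] by (auto simp: M_def intro!: dvd_diff_ent)
        show "\<zero> \<in> M"
          using radD[OF zero_in_rad] xy by (auto simp: M_def)
      qed (auto simp: M_def)
      have Mmult: "c \<otimes> b \<in> M" if b: "b \<in> M" and c: "c \<in> carrier R" for b c
      proof -
        have bR: "b \<in> carrier R" using b by (simp add: M_def)
        have "int p dvd ent (c \<otimes> b) z y" if z: "z \<in> Ix" "fst z = fst y" for z
        proof (rule ent_mult_dvd[OF c bR z(1) xy(2) p_dvd_q[OF xy(2)]])
          fix v assume v: "v \<in> Ix"
          show "int p dvd ent c z v * ent b v y"
            using p_dvd_ent_off_level[OF c z(1) v] p_dvd_ent_off_level[OF bR v xy(2)] z(2) b v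
            by (cases "fst v" "fst y" rule: linorder_cases) (auto simp: M_def)
        qed
        then show ?thesis using bR c by (simp add: M_def)
      qed
      have "maximal_left_ideal M R"
        unfolding maximal_left_ideal_def
      proof (intro conjI allI impI)
        show "left_ideal M R" using Msub Mmult by (simp add: left_ideal_def)
        have "\<not> int p dvd ent \<one> y y"
          using dvd_cong_iff[OF ent_one[OF xy(2,2)] p_dvd_q[OF xy(2)]]
            prime_gt_1_nat[OF p] by simp
        then have "\<one> \<notin> M" using xy by (auto simp: M_def)
        then show "M \<noteq> carrier R" by auto
        fix I assume I: "left_ideal I R" "M \<subseteq> I"
        interpret I: additive_subgroup I R using I(1) by (simp add: left_ideal_def)
        have Imult: "\<And>b c. b \<in> I \<Longrightarrow> c \<in> carrier R \<Longrightarrow> c \<otimes> b \<in> I"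
          using I(1) by (simp add: left_ideal_def)
        show "I = M \<or> I = carrier R"
        proof (rule disjCI)
          assume "I \<noteq> carrier R"
          have "b \<in> M" if b: "b \<in> I" for b
          proof (rule ccontr)
            assume "b \<notin> M"
            have bR: "b \<in> carrier R" using b by simp
            then obtain z where z: "z \<in> Ix" "fst z = fst y" "\<not> int p dvd ent b z y"
              using \<open>b \<notin> M\<close> by (auto simp: M_def)
            then have "coprime (ent b z y) (int p)"
              using prime_imp_coprime[OF prime_P] coprime_commute by blast
            then obtain u where u: "[ent b z y * u = 1] (mod int p)"
              using cong_solve_coprime_int by blast
            have lev: "P (n (fst z) - n (fst y)) dvd u" using z by simp
            \<comment> \<open>Since \<open>u\<close> inverts the entry at \<open>(z, y)\<close>
              modulo \<open>p\<close>, column \<open>y\<close> of \<open>?c\<close> agrees modulo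
              \<open>p\<close> with that of \<one> on this level.\<close>
            let ?c = "E y z u \<otimes> b"
            have c: "?c \<in> I" "?c \<in> carrier R"
              using Imult[OF b] E_closed[OF xy(2) z(1) lev] bR by auto
            have "\<one> \<ominus> ?c \<in> M"
            proof -
              have "int p dvd ent (\<one> \<ominus> ?c) v y" if v: "v \<in> Ix" "fst v = fst y" for v
              proof -
                have "[ent (\<one> \<ominus> ?c) v y = ent \<one> v y - ent ?c v y] (mod int p)"
                  using cong_dvd_modulus[OF ent_diff p_dvd_q] c v xy by blast
                also have "[ent \<one> v y - ent ?c v y =
                    (if v = y then 1 else 0) - (if v = y then u * ent b z y else 0)] (mod int p)"
                  using cong_dvd_modulus[OF ent_one[OF v(1) xy(2)] p_dvd_q[OF xy(2)]]
                    cong_dvd_modulus[OF ent_E_mult[OF xy(2) z(1) lev bR v(1) xy(2)] p_dvd_q[OF xy(2)]]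
                  by (rule cong_diff)
                also have "[(if v = y then 1 else 0) - (if v = y then u * ent b z y else 0) = 0] (mod int p)"
                  using cong_diff[OF cong_refl[of 1] u] by (simp add: mult.commute)
                finally show ?thesis by (simp add: cong_0_iff)
              qed
              then show ?thesis using c by (simp add: M_def)
            qed
            then have "(\<one> \<ominus> ?c) \<oplus> ?c \<in> I" using I(2) c(1) by blast
            then have one: "\<one> \<in> I" using c(2) by (simp add: diff_add_cancel)
            have "x \<in> I" if "x \<in> carrier R" for x using Imult[OF one that] that by simp
            then show False using \<open>I \<noteq> carrier R\<close> I.a_subset by blast
          qed
          then show "I = M" using I(2) by blast
        qed
      qed
      then have "a \<in> M" using a by (auto simp: jacobson_radical_def)
      then show "int p dvd ent a x y" using xy unfolding M_def by blast
    qed (use a in \<open>simp add: jacobson_radical_def\<close>)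
  qed
qed

lemma upper_annihilating_eq_ann: "upper_annihilating R t = ann t"
  by (induction t) (simp_all add: ann_0 ann_Suc jacobson_radical_eq_rad)

text \<open>\<open>Delta\<close> with an abstract matrix ring in place of \<open>End_ring G\<close>;
  for the endomorphism ring the two agree by unfolding.\<close>

definition D :: "'a monoid" where
  "D = (units_of R)\<lparr>carrier := jacobson_radical R +> \<one>\<rparr>"

lemma carrier_D: "carrier D = {a \<oplus> \<one> | a. a \<in> rad}"
  by (auto simp: D_def jacobson_radical_eq_rad a_r_coset_def')

lemma mult_D [simp]: "x \<otimes>\<^bsub>D\<^esub> y = x \<otimes> y"
  by (simp add: D_def units_of_def)

lemma one_D [simp]: "\<one>\<^bsub>D\<^esub> = \<one>"
  by (simp add: D_def units_of_def)

lemma carrier_D_R: "x \<in> carrier D \<Longrightarrow> x \<in> carrier R"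
  by (auto simp: carrier_D)

lemma group_D: "group D"
proof (rule groupI)
  fix x y assume "x \<in> carrier D" "y \<in> carrier D"
  then obtain a b where ab: "a \<in> rad" "b \<in> rad" "x = a \<oplus> \<one>" "y = b \<oplus> \<one>"
    by (auto simp: carrier_D)
  then have "x \<otimes> y = (a \<otimes> b \<oplus> (a \<oplus> b)) \<oplus> \<one>" by (simp add: one_plus_mult a_assoc)
  moreover have "a \<otimes> b \<oplus> (a \<oplus> b) \<in> rad" 
    by (rule rad_add[OF rad_mult_right[OF ab(1) rad_closed[OF ab(2)]] rad_add[OF ab(1,2)]])
  ultimately show "x \<otimes>\<^bsub>D\<^esub> y \<in> carrier D" by (auto simp: carrier_D)
next
  have "\<one> = \<zero> \<oplus> \<one>" by simp
  then show "\<one>\<^bsub>D\<^esub> \<in> carrier D" using zero_in_rad unfolding carrier_D one_D by blast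
next
  fix x assume "x \<in> carrier D"
  then obtain a where a: "a \<in> rad" "x = a \<oplus> \<one>" by (auto simp: carrier_D)
  obtain b where "b \<in> rad" "(b \<oplus> \<one>) \<otimes> x = \<one>" using one_plus_inverse[OF a(1)] a(2) by metis
  then show "\<exists>y\<in>carrier D. y \<otimes>\<^bsub>D\<^esub> x = \<one>\<^bsub>D\<^esub>" by (auto simp: carrier_D)
qed (simp_all add: m_assoc carrier_D_R)

end

section \<open>Commutators with elementary matrices\<close>

context matrix_ring
begin

definition comm :: "'a \<Rightarrow> 'a \<Rightarrow> 'a" where
  "comm a b = a \<otimes> b \<ominus> b \<otimes> a"

lemma comm_closed [simp]: "a \<in> carrier R \<Longrightarrow> b \<in> carrier R \<Longrightarrow> comm a b \<in> carrier R"
  by (simp add: comm_def)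

text \<open>An integer formula for the entry of \<open>comm a (F x y)\<close> at
  \<open>(z, v)\<close>. Only column \<open>y\<close> and row \<open>x\<close> survive, so a test of
  this kind isolates single entries of \<open>a\<close>.\<close>

definition comm_entry :: "'a \<Rightarrow> nat \<times> 'b \<Rightarrow> nat \<times> 'b \<Rightarrow> nat \<times> 'b \<Rightarrow> nat \<times> 'b \<Rightarrow> int" where
  "comm_entry a x y z v =
     (if v = y then ent a z x * unit_entry x y else 0) - (if z = x then unit_entry x y * ent a y v else 0)"

lemma F_closed [simp]: "x \<in> Ix \<Longrightarrow> y \<in> Ix \<Longrightarrow> F x y \<in> carrier R"
  by (rule rad_closed[OF F_rad])

lemma ent_comm_F:
  assumes "a \<in> carrier R" "x \<in> Ix" "y \<in> Ix" "z \<in> Ix" "v \<in> Ix"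
  shows "[ent (comm a (F x y)) z v = comm_entry a x y z v] (mod P (n (fst v)))"
proof -
  have F: "F x y \<in> carrier R" using assms by simp
  have "[ent (comm a (F x y)) z v = ent (a \<otimes> F x y) z v - ent (F x y \<otimes> a) z v] (mod P (n (fst v)))"
    unfolding comm_def using assms F by (intro ent_diff) simp_all
  also have "[ent (a \<otimes> F x y) z v - ent (F x y \<otimes> a) z v = comm_entry a x y z v] (mod P (n (fst v)))"
    unfolding comm_entry_def
    by (intro cong_diff ent_mult_E ent_E_mult unit_entry_dvd assms)
  finally show ?thesis .
qed

lemma comm_F_dvd:
  assumes "comm a (F x y) \<in> ann t" "a \<in> carrier R" "x \<in> Ix" "y \<in> Ix" "z \<in> Ix" "v \<in> Ix"
  shows "P (n (fst v) - \<alpha> (fst z) (fst v) t) dvd comm_entry a x y z v"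
  using annD[OF assms(1,5,6)] dvd_cong_iff[OF ent_comm_F[OF assms(2-6)] P_diff_dvd] by simp

lemma smul_rad: "int p dvd c \<Longrightarrow> smul c \<one> \<in> rad"
proof (rule radI)
  fix x y assume c: "int p dvd c" and xy: "x \<in> Ix" "y \<in> Ix"
  show "int p dvd ent (smul c \<one>) x y"
    using dvd_cong_iff[OF ent_scalar_one[OF xy] p_dvd_q[OF xy(2)]] c by simp
qed simp

lemma smul_ann:
  assumes "int p dvd c" "P (n s - \<alpha> s s t) dvd c"
  shows "smul c \<one> \<in> ann t"
proof (rule annI[OF smul_rad[OF assms(1)]])
  fix x y assume xy: "x \<in> Ix" "y \<in> Ix"
  have "P (n (fst y) - \<alpha> (fst y) (fst y) t) dvd P (n s - \<alpha> s s t)"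
    using xy by (intro le_imp_power_dvd upper_fun_diagonal_le) auto
  then have "P (n (fst y) - \<alpha> (fst y) (fst y) t) dvd c" using assms(2) by (rule dvd_trans)
  then show "P (n (fst y) - \<alpha> (fst x) (fst y) t) dvd ent (smul c \<one>) x y"
    using dvd_cong_iff[OF ent_scalar_one[OF xy] P_diff_dvd] by (cases "x = y") auto
qed

lemma smul_one_mult: "b \<in> carrier R \<Longrightarrow> smul c \<one> \<otimes> b = smul c b"
  by (simp add: add_pow_ldistr_int)

lemma mult_smul_one: "b \<in> carrier R \<Longrightarrow> b \<otimes> smul c \<one> = smul c b"
  by (simp add: add_pow_rdistr_int)

text \<open>Adding \<one> gives \<open>(1 + J\<^sub>t) Z\<close>: membership in \<open>rad\<close>
  forces the scalar to be divisible by \<open>p\<close>, and \<open>1 + c\<close> is then a central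
  element of \<open>D\<close>.\<close>

definition cen :: "nat \<Rightarrow> 'a set" where
  "cen t = {a \<in> rad. \<exists>c. int p dvd c \<and> a \<ominus> smul c \<one> \<in> ann t}"

lemma diff_smul_ann:
  assumes "a \<in> rad" "int p dvd c"
  shows "a \<ominus> smul c \<one> \<in> ann t \<longleftrightarrow>
    (\<forall>x\<in>Ix. \<forall>y\<in>Ix. P (n (fst y) - \<alpha> (fst x) (fst y) t) dvd ent a x y - (if x = y then c else 0))"
proof -
  have ent: "P (n (fst y) - \<alpha> (fst x) (fst y) t) dvd ent (a \<ominus> smul c \<one>) x y \<longleftrightarrow>
      P (n (fst y) - \<alpha> (fst x) (fst y) t) dvd ent a x y - (if x = y then c else 0)"
    if "x \<in> Ix" "y \<in> Ix" for x y
  proof (rule dvd_cong_iff[OF _ P_diff_dvd])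
    have "[ent (a \<ominus> smul c \<one>) x y = ent a x y - ent (smul c \<one>) x y] (mod P (n (fst y)))"
      using assms that by (intro ent_diff) simp_all
    also have "[ent a x y - ent (smul c \<one>) x y = ent a x y - (if x = y then c else 0)] (mod P (n (fst y)))"
      using that by (intro cong_diff ent_scalar_one) auto
    finally show "[ent (a \<ominus> smul c \<one>) x y = ent a x y - (if x = y then c else 0)] (mod P (n (fst y)))" .
  qed
  have "a \<ominus> smul c \<one> \<in> rad" using assms by (intro rad_diff smul_rad)
  then have "a \<ominus> smul c \<one> \<in> ann t \<longleftrightarrow>
      (\<forall>x\<in>Ix. \<forall>y\<in>Ix. P (n (fst y) - \<alpha> (fst x) (fst y) t) dvd ent (a \<ominus> smul c \<one>) x y)"
    unfolding ann_def by blast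
  then show ?thesis using ent by blast
qed

text \<open>For \<open>x \<noteq> y\<close> the commutator with \<open>F y v\<close> has the entry
  of \<open>a\<close> at \<open>(x, y)\<close>, times the unit entry, at \<open>(x, v)\<close>; this
  feeds the recursion directly. Diagonal entries are visible only through their differences, so they
  are compared with the one at \<open>r\<close> on the top level and then downwards, one level at a
  time.\<close>

lemma cen_of_comm_F:
  assumes a: "a \<in> rad" and r: "r \<in> Ix" "fst r = s"
    and comm: "\<And>x y. x \<in> Ix \<Longrightarrow> y \<in> Ix \<Longrightarrow> adj x y \<Longrightarrow> comm a (F x y) \<in> ann t"
  shows "a \<ominus> smul (ent a r r) \<one> \<in> ann (Suc t)"
proof -
  have aR: "a \<in> carrier R" using a by simp
  have off: "P (n (fst y) - \<alpha> (fst x) (fst y) (Suc t)) dvd ent a x y"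
    if x: "x \<in> Ix" and y: "y \<in> Ix" and "x \<noteq> y" for x y
  proof (rule dvd_entry_Suc[OF x y])
    fix v assume v: "v \<in> Ix"
    show "P (n (fst v) - \<alpha> (fst x) (fst v) t) dvd ent a x y * unit_entry y v" if "adj y v"
      using comm_F_dvd[OF comm[OF y v that] aR y v x v] \<open>x \<noteq> y\<close> by (simp add: comm_entry_def)
    show "P (n (fst y) - \<alpha> (fst v) (fst y) t) dvd unit_entry v x * ent a x y" if "adj v x"
      using comm_F_dvd[OF comm[OF v x that] aR v x v y] \<open>x \<noteq> y\<close> by (simp add: comm_entry_def)
  qed
  have diag: "P (n (fst v) - \<alpha> (fst x) (fst v) t) dvd unit_entry x v * (ent a x x - ent a v v)"
    if x: "x \<in> Ix" and v: "v \<in> Ix" and "adj x v" for x v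
    using comm_F_dvd[OF comm[OF x v that(3)] aR x v x v]
    by (cases "x = v") (auto simp: comm_entry_def algebra_simps)
  have top: "P (n s - \<alpha> s s (Suc t)) dvd ent a x x - ent a r r" if x: "x \<in> Ix" "fst x = s" for x
  proof -
    \<comment> \<open>The difference is treated like an entry at \<open>(x, x)\<close>, every test
      passing through an index \<open>v\<close> adjacent to both \<open>x\<close> and
      \<open>r\<close>. Comparing \<open>x\<close> with \<open>r\<close> directly would give only
      \<open>\<alpha> s s t + 1\<close>, which can exceed
      \<open>\<alpha> s s (Suc t)\<close>.\<close>
    have "P (n (fst x) - \<alpha> (fst x) (fst x) (Suc t)) dvd ent a x x - ent a r r"
    proof (rule dvd_entry_Suc[OF x(1) x(1)])
      fix v assume v: "v \<in> Ix"
      show "P (n (fst v) - \<alpha> (fst x) (fst v) t) dvd (ent a x x - ent a r r) * unit_entry x v" if "adj x v"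
      proof -
        have "adj r v" and u: "unit_entry r v = unit_entry x v"
          using that x r by (simp_all add: adj_def unit_entry_def)
        then have "P (n (fst v) - \<alpha> (fst x) (fst v) t) dvd
            unit_entry x v * (ent a x x - ent a v v) - unit_entry x v * (ent a r r - ent a v v)"
          using diag[OF x(1) v that] diag[OF r(1) v] x r by (intro dvd_diff) simp_all
        then show ?thesis by (simp add: algebra_simps)
      qed
      show "P (n (fst x) - \<alpha> (fst v) (fst x) t) dvd unit_entry v x * (ent a x x - ent a r r)" if "adj v x"
      proof -
        have "adj v r" and u: "unit_entry v r = unit_entry v x"
          using that x r by (simp_all add: adj_def unit_entry_def)
        then have "P (n (fst x) - \<alpha> (fst v) (fst x) t) dvd
            unit_entry v x * (ent a v v - ent a r r) - unit_entry v x * (ent a v v - ent a x x)"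
          using diag[OF v x(1) that] diag[OF v r(1)] x r by (intro dvd_diff) simp_all
        then show ?thesis by (simp add: algebra_simps)
      qed
    qed
    then show ?thesis using x by simp
  qed
  have diagonal: "\<forall>x\<in>Ix. fst x = j \<longrightarrow> P (n j - \<alpha> j j (Suc t)) dvd ent a x x - ent a r r"
    if "j \<le> s" "1 \<le> j" for j
    using that
  proof (induction j rule: inc_induct)
    case base
    then show ?case using top by blast
  next
    case (step j)
    obtain y where y: "y \<in> Ix" "fst y = Suc j"
      using B_nonempty[of "Suc j"] step.hyps by force
    show ?case
    proof (intro ballI impI)
      fix x assume x: "x \<in> Ix" "fst x = j"
      have le: "n j \<le> n (Suc j)" and less: "n j < n (Suc j)"
        using step n_le[of j "Suc j"] n_less[of j "Suc j"] by auto
      have "P (n (Suc j) - \<alpha> j (Suc j) t) dvd (ent a x x - ent a y y) * P (n (Suc j) - n j)"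
        using diag[OF x(1) y(1)] x y by (simp add: adj_def unit_entry_def mult.commute)
      then have "P (n (Suc j) - \<alpha> j (Suc j) t - (n (Suc j) - n j)) dvd ent a x x - ent a y y"
        by (rule power_dvd_mult_powerD[rotated]) simp
      moreover have "n (Suc j) - \<alpha> j (Suc j) t - (n (Suc j) - n j) = n j - \<alpha> j j (Suc t)"
        using upper_fun_diagonal_Suc[of j t] step le by simp
      ultimately have 1: "P (n j - \<alpha> j j (Suc t)) dvd ent a x x - ent a y y" by simp
      have "P (n j - \<alpha> j j (Suc t)) dvd P (n (Suc j) - \<alpha> (Suc j) (Suc j) (Suc t))"
        using step by (intro le_imp_power_dvd upper_fun_diagonal_le) auto
      also have "\<dots> dvd ent a y y - ent a r r"
        using step.IH[OF Suc_le_mono[THEN iffD2, OF le0, folded One_nat_def]] y by blast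
      finally have "P (n j - \<alpha> j j (Suc t)) dvd (ent a x x - ent a y y) + (ent a y y - ent a r r)"
        by (rule dvd_add[OF 1])
      then show "P (n j - \<alpha> j j (Suc t)) dvd ent a x x - ent a r r" by simp
    qed
  qed
  have "P (n (fst y) - \<alpha> (fst x) (fst y) (Suc t)) dvd ent a x y - (if x = y then ent a r r else 0)"
    if "x \<in> Ix" "y \<in> Ix" for x y
    using off[OF that] diagonal[of "fst x"] that by (cases "x = y") auto
  then show ?thesis
    using diff_smul_ann[OF a radD[OF a r(1) r(1)]] by blast
qed

text \<open>The congruence at \<open>(r, r)\<close> determines \<open>c\<close> up to a scalar that
  lies in \<open>ann t\<close> by \<open>smul_ann\<close>, so \<open>c\<close> may be replaced by
  the entry of \<open>a\<close> there.\<close>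

lemma cen_eq:
  assumes "r \<in> Ix" "fst r = s"
  shows "cen t = {a \<in> rad. a \<ominus> smul (ent a r r) \<one> \<in> ann t}"
proof -
  have *: "a \<ominus> smul (ent a r r) \<one> \<in> ann t"
    if a: "a \<in> rad" and c: "int p dvd c" "a \<ominus> smul c \<one> \<in> ann t" for a c
  proof -
    have aR: "a \<in> carrier R" using a by simp
    have "\<forall>x\<in>Ix. \<forall>y\<in>Ix. P (n (fst y) - \<alpha> (fst x) (fst y) t) dvd ent a x y - (if x = y then c else 0)"
      using c diff_smul_ann[OF a] by blast
    from bspec[OF bspec[OF this assms(1)] assms(1)]
    have "P (n s - \<alpha> s s t) dvd ent a r r - c" using assms(2) by simp
    then have "P (n s - \<alpha> s s t) dvd c - ent a r r" by (simp add: dvd_diff_commute)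
    moreover have "int p dvd c - ent a r r" using c radD[OF a] assms by simp
    ultimately have "smul (c - ent a r r) \<one> \<in> ann t" by (intro smul_ann)
    then have "(a \<ominus> smul c \<one>) \<oplus> smul (c - ent a r r) \<one> \<in> ann t" using c(2) by (rule ann_add[rotated])
    moreover have "(a \<ominus> smul c \<one>) \<oplus> smul (c - ent a r r) \<one> = a \<ominus> smul (ent a r r) \<one>"
    proof -
      have "smul (c - ent a r r) \<one> = smul c \<one> \<ominus> smul (ent a r r) \<one>"
        using add.int_pow_diff[OF one_closed, of c "ent a r r"] by (simp add: minus_eq)
      then show ?thesis using aR by (simp add: minus_eq a_assoc l_neg r_neg1)
    qed
    ultimately show ?thesis by simp
  qed
  have p_r: "int p dvd ent a r r" if "a \<in> rad" for a
    by (rule radD[OF that assms(1,1) refl])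
  show ?thesis
  proof (rule Set.set_eqI, rule iffI)
    fix a assume "a \<in> cen t"
    then obtain c where "a \<in> rad" "int p dvd c" "a \<ominus> smul c \<one> \<in> ann t"
      unfolding cen_def by blast
    then show "a \<in> {a \<in> rad. a \<ominus> smul (ent a r r) \<one> \<in> ann t}" using * by blast
  next
    fix a assume "a \<in> {a \<in> rad. a \<ominus> smul (ent a r r) \<one> \<in> ann t}"
    then show "a \<in> cen t" using p_r unfolding cen_def by blast
  qed
qed

text \<open>If \<open>\<alpha> (s - 1) s t < \<alpha> s s t\<close>, the bound on \<open>h\<close>
  reaches the top modulus and \<open>c * u\<close> is divisible. Otherwise the minimum at
  \<open>(s, s)\<close> is attained by a descent; then the moduli at levels \<open>s\<close> and
  \<open>s - 1\<close> agree and adding gives \<open>c * (u + u')\<close> with \<open>u + u'\<close>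
  congruent to 2. For \<open>q = 2\<close> a descent costs at least 2, which restores the strict
  inequality.\<close>

lemma dvd_of_diagonal_commutator:
  assumes q: "q = 2 \<longrightarrow> 2 \<le> n s - n (s - 1)" "Factorial_Ring.prime q" "2 \<le> s" "1 \<le> t"
    and u: "[u = 1] (mod int q)" "[u' = 1] (mod int q)"
    and top: "int q ^ (n s - \<alpha> s s t) dvd h - c * u"
    and below: "int q ^ (n (s - 1) - \<alpha> (s - 1) (s - 1) t) dvd - h - c * u'"
    and h: "int q ^ (n s - \<alpha> (s - 1) s t - 1) dvd h"
  shows "int q ^ (n s - \<alpha> s s t) dvd c"
proof -
  obtain \<tau> where t: "t = Suc \<tau>" using assms(4) by (cases t) auto
  have lev: "s \<in> {1..s}" "s - 1 \<in> {1..s}" "Suc (s - 1) = s" "1 \<le> s - 1" "s - 1 < s" using assms(3) by auto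
  have n: "n (s - 1) < n s" using n_less[of "s - 1" s] lev by simp
  have pq: "Factorial_Ring.prime (int q)" using q(2) by simp
  have cu: "int q ^ (n s - \<alpha> s s t) dvd c * u" if "\<alpha> (s - 1) s t < \<alpha> s s t"
  proof -
    have "int q ^ (n s - \<alpha> s s t) dvd h"
      using that by (intro dvd_trans[OF le_imp_power_dvd h]) simp
    from dvd_diff[OF this top] show ?thesis by simp
  qed
  have strict: ?thesis if "\<alpha> (s - 1) s t < \<alpha> s s t"
    by (rule dvd_mult_cong_1[OF pq u(1) cu[OF that]])
  have down: ?thesis if ss: "\<alpha> s s t = n s - n (s - 1) + \<alpha> (s - 1) s \<tau>"
  proof (cases "q = 2")
    case True
    then show ?thesis
      using ss[unfolded t] q(1)[rule_format, OF True] upper_fun_stay[OF lev(2,1), of \<tau>]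
      by (intro strict) (simp only: t)
  next
    case False
    have eq: "n (s - 1) - \<alpha> (s - 1) (s - 1) t = n s - \<alpha> s s t"
      using upper_fun_diagonal_Suc[OF lev(4,5), of \<tau>] ss t n lev(3) by simp
    have "int q ^ (n s - \<alpha> s s t) dvd - ((h - c * u) + (- h - c * u'))"
      using dvd_add[OF top below[unfolded eq]] by (simp only: dvd_minus_iff)
    then have "int q ^ (n s - \<alpha> s s t) dvd c * (u + u')" by (simp add: algebra_simps)
    moreover have "\<not> int q dvd u + u'"
    proof -
      have "[u + u' = 2] (mod int q)" using cong_add[OF u] by simp
      moreover have "\<not> q dvd 2"
        using False q(2) primes_dvd_imp_eq[OF q(2) two_is_prime_nat] by blast
      then have "\<not> int q dvd 2" by (metis int_dvd_int_iff of_nat_numeral)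
      ultimately show ?thesis using cong_dvd_iff by blast
    qed
    then have "coprime (int q ^ (n s - \<alpha> s s t)) (u + u')"
      using prime_imp_coprime[OF pq] by simp
    ultimately show ?thesis using coprime_dvd_mult_left_iff by blast
  qed
  from lev(1,1) show ?thesis
  proof (cases rule: upper_fun_Suc_cases[where t = \<tau>])
    case stay
    then show ?thesis using upper_fun_up_left[OF lev(2,1,5), of \<tau>] lev(3) t by (intro strict) simp
  next
    case (down_right k)
    then have "k = s - 1" by simp
    then show ?thesis using down down_right upper_fun_commute[OF lev(1,2)] t by simp
  next
    case (down_left k)
    then have "k = s - 1" by simp
    then show ?thesis using down down_left t by simp
  qed auto
qed

text \<open>The commutator of the group elements \<open>1 + a\<close> and \<open>1 + b\<close> lies in \<open>Z\<close> modulo \<open>ann t\<close> if and only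
  if \<open>comm a b\<close> is a multiple \<open>c (1 + b) (1 + a)\<close> modulo \<open>ann t\<close>.  Since \<open>(1 + b) (1 + a)\<close> has unit
  diagonal entries, \<open>c\<close> can be read off from any diagonal entry of \<open>comm a b\<close> at level \<open>s\<close>.\<close>

lemma comm_F_of_scalar:
  assumes t: "1 \<le> t" and a: "a \<in> rad" and r: "r \<in> Ix" "fst r = s"
    and cond: "(p = 2 \<longrightarrow> 2 \<le> s \<longrightarrow> 2 \<le> n s - n (s - 1)) \<or> (\<exists>r'\<in>Ix. fst r' = s \<and> r' \<noteq> r)"
    and scalar: "\<And>b. b \<in> rad \<Longrightarrow> \<exists>c. int p dvd c \<and>
      comm a b \<ominus> smul c ((b \<oplus> \<one>) \<otimes> (a \<oplus> \<one>)) \<in> ann t"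
    and x: "x \<in> Ix" and y: "y \<in> Ix" and xy: "adj x y"
  shows "comm a (F x y) \<in> ann t"
proof -
  have aR: "a \<in> carrier R" using a by simp
  have key: "\<exists>c u. (\<forall>z\<in>Ix. [u z = 1] (mod int p)) \<and>
      (\<forall>z\<in>Ix. P (n (fst z) - \<alpha> (fst z) (fst z) t) dvd comm_entry a x y z z - c * u z) \<and>
      (P (n s - \<alpha> s s t) dvd c \<longrightarrow> comm a (F x y) \<in> ann t)" if x: "x \<in> Ix" and y: "y \<in> Ix" for x y
  proof -
    let ?w = "(F x y \<oplus> \<one>) \<otimes> (a \<oplus> \<one>)"
    obtain c where c: "int p dvd c" "comm a (F x y) \<ominus> smul c ?w \<in> ann t"
      using scalar[OF F_rad[OF x y]] by blast
    have F: "F x y \<in> carrier R" and wR: "?w \<in> carrier R" using x y aR by simp_all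
    have 1: "[ent ?w z z = 1] (mod int p)" if z: "z \<in> Ix" for z
    proof -
      let ?e = "F x y \<otimes> a \<oplus> (F x y \<oplus> a)"
      have "?e \<in> rad" using a F_rad[OF x y] F by (intro rad_add rad_mult_left)
      have w: "?w = ?e \<oplus> \<one>" using aR F by (simp add: one_plus_mult a_assoc)
      have "[ent ?w z z = ent ?e z z + ent \<one> z z] (mod int p)"
        unfolding w using \<open>?e \<in> rad\<close> z by (intro cong_dvd_modulus[OF ent_add p_dvd_q[OF z]]) simp_all
      also have "[ent ?e z z + ent \<one> z z = 0 + 1] (mod int p)"
        using radD[OF \<open>?e \<in> rad\<close> z z] cong_dvd_modulus[OF ent_one[OF z z] p_dvd_q[OF z]]
        by (intro cong_add) (simp_all add: cong_0_iff)
      finally show ?thesis by simp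
    qed
    have 2: "P (n (fst z) - \<alpha> (fst z) (fst z) t) dvd comm_entry a x y z z - c * ent ?w z z"
      if z: "z \<in> Ix" for z
    proof -
      have "[ent (comm a (F x y) \<ominus> smul c ?w) z z = ent (comm a (F x y)) z z - ent (smul c ?w) z z]
          (mod P (n (fst z)))"
        using aR F wR z by (intro ent_diff) simp_all
      also have "[ent (comm a (F x y)) z z - ent (smul c ?w) z z =
          comm_entry a x y z z - c * ent ?w z z] (mod P (n (fst z)))"
        using aR x y z wR by (intro cong_diff ent_comm_F ent_scalar)
      finally show ?thesis using annD[OF c(2) z z] dvd_cong_iff P_diff_dvd by blast
    qed
    have 3: "comm a (F x y) \<in> ann t" if "P (n s - \<alpha> s s t) dvd c"
    proof -
      have "smul c ?w \<in> ann t"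
        using ann_mult_right[OF smul_ann[OF c(1) that] wR] wR by (simp only: smul_one_mult)
      then have "(comm a (F x y) \<ominus> smul c ?w) \<oplus> smul c ?w \<in> ann t" by (rule ann_add[OF c(2)])
      moreover have "(comm a (F x y) \<ominus> smul c ?w) \<oplus> smul c ?w = comm a (F x y)"
        by (rule diff_add_cancel[OF comm_closed[OF aR F] add.int_pow_closed[OF wR]])
      ultimately show ?thesis by simp
    qed
    show ?thesis
      by (rule exI[of _ c], rule exI[of _ "\<lambda>z. ent ?w z z"]) (blast intro: 1 2 3)
  qed
  \<comment> \<open>One top diagonal entry of the commutator that vanishes modulo the top modulus
    suffices to kill the scalar.\<close>
  have zero: "comm a (F x y) \<in> ann t"
    if x: "x \<in> Ix" and y: "y \<in> Ix" and z: "z \<in> Ix" "fst z = s"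
      and h: "P (n s - \<alpha> s s t) dvd comm_entry a x y z z" for x y z
  proof -
    obtain c u where cu: "\<forall>z\<in>Ix. [u z = 1] (mod int p)"
      "\<forall>z\<in>Ix. P (n (fst z) - \<alpha> (fst z) (fst z) t) dvd comm_entry a x y z z - c * u z"
      "P (n s - \<alpha> s s t) dvd c \<longrightarrow> comm a (F x y) \<in> ann t"
      using key[OF x y] by blast
    from dvd_diff[OF h bspec[OF cu(2) z(1), unfolded z(2)]]
    have "P (n s - \<alpha> s s t) dvd c * u z" by simp
    from dvd_mult_cong_1[OF prime_P bspec[OF cu(1) z(1)] this] show ?thesis using cu(3) by blast
  qed
  \<comment> \<open>On the diagonal the two contributions to \<open>comm a (F x x)\<close> cancel.
    The resulting bound \<open>pdvd\<close> on the off-diagonal entries of \<open>a\<close>, up to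
    one factor \<open>p\<close>, is what the harder cases below live on.\<close>
  have same: "comm a (F x x) \<in> ann t" if x: "x \<in> Ix" for x
    by (rule zero[OF x x r]) (simp add: comm_entry_def)
  have pdvd: "P (n (fst v) - \<alpha> (fst z) (fst v) t) dvd int p * ent a z v"
    if z: "z \<in> Ix" and v: "v \<in> Ix" and "z \<noteq> v" for z v
    using comm_F_dvd[OF same[OF v] aR v v z v] that by (simp add: comm_entry_def unit_entry_def mult.commute)
  show ?thesis
  proof (cases "x = y")
    case True
    then show ?thesis using same x by simp
  next
    case False
    \<comment> \<open>Difficulties arise only if every top basis element is \<open>x\<close> or
      \<open>y\<close>: either two of them are joined within the level, or a lone one is joined to
      level \<open>s - 1\<close>.\<close>
    consider (other) z where "z \<in> Ix" "fst z = s" "z \<noteq> x" "z \<noteq> y"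
      | (both) "fst x = s" "fst y = s"
      | (single) "\<And>z. z \<in> Ix \<Longrightarrow> fst z = s \<Longrightarrow> z = r" "x = r \<or> y = r"
      using r by (cases "x = r"; cases "y = r") blast+
    then show ?thesis
    proof cases
      case (other z)
      then show ?thesis by (intro zero[OF x y, of z]) (simp_all add: comm_entry_def)
    next
      case both
      then have "unit_entry x y = int p" by (simp add: unit_entry_def)
      then show ?thesis
        using pdvd[OF y x] False both
        by (intro zero[OF x y y]) (simp_all add: comm_entry_def mult.commute)
    next
      case single
      define v where "v = (if x = r then y else x)"
      have v: "v \<in> Ix" "v \<noteq> r" "adj r v"
      proof -
        show "v \<in> Ix" unfolding v_def using x y by (cases "x = r") simp_all
        show "v \<noteq> r" unfolding v_def using False by (cases "x = r") simp_all
        show "adj r v"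
        proof (cases "x = r")
          case True
          then show ?thesis using xy by (simp add: v_def)
        next
          case False
          then have "y = r" using single(2) by blast
          then show ?thesis using xy False by (auto simp: v_def adj_def)
        qed
      qed
      have "fst v \<noteq> s" using single(1)[OF v(1)] v(2) by blast
      moreover have v_bounds: "1 \<le> fst v" "fst v \<le> s" using v(1) by auto
      ultimately have "s = Suc (fst v)" using v(3) r(2) unfolding adj_def by linarith
      then have lev: "fst v = s - 1" "2 \<le> s" "s - 1 \<in> {1..s}" "s \<in> {1..s}"
        using v_bounds by auto
      have gap: "n (s - 1) < n s" using n_less[of "s - 1" s] lev by simp
      obtain c u where cu: "\<forall>z\<in>Ix. [u z = 1] (mod int p)"
        "\<forall>z\<in>Ix. P (n (fst z) - \<alpha> (fst z) (fst z) t) dvd comm_entry a x y z z - c * u z"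
        "P (n s - \<alpha> s s t) dvd c \<longrightarrow> comm a (F x y) \<in> ann t"
        using key[OF x y] by blast
      have neg: "comm_entry a x y v v = - comm_entry a x y r r"
      proof (cases "x = r")
        case True
        then have "y = v" by (simp add: v_def)
        then show ?thesis using True v(2) by (simp add: comm_entry_def)
      next
        case False
        then have "y = r" "x = v" using single(2) by (auto simp: v_def)
        then show ?thesis using v(2) by (simp add: comm_entry_def)
      qed
      \<comment> \<open>Up to sign the entry at \<open>(r, r)\<close> is the entry of
        \<open>a\<close> at \<open>(v, r)\<close>, or the one at \<open>(r, v)\<close> times the
        power of \<open>p\<close> for the gap. In both cases \<open>pdvd\<close> bounds it up to one
        factor \<open>p\<close>, the source of the \<open>- 1\<close> in the exponent.\<close>
      have "P (n s - \<alpha> (s - 1) s t) dvd comm_entry a x y r r * int p"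
      proof (cases "x = r")
        case True
        then have xy: "y = v" by (simp add: v_def)
        have "fst r \<noteq> fst v" using lev r(2) by simp
        then have "unit_entry r v = 1"
          using lev(1) r(2) gap by (simp add: unit_entry_def)
        then have "comm_entry a x y r r = - ent a v r"
          using v(2) xy \<open>x = r\<close> by (simp add: comm_entry_def)
        then show ?thesis using pdvd[OF v(1) r(1) v(2)] lev r by (simp add: mult.commute)
      next
        case False
        then have xy: "y = r" "x = v" using single(2) by (auto simp: v_def)
        have "fst v \<noteq> fst r" using lev r(2) by simp
        then have "unit_entry v r = P (n s - n (s - 1))"
          using lev(1) r(2) by (simp add: unit_entry_def)
        then have "comm_entry a x y r r = ent a r v * P (n s - n (s - 1))"
          using v(2) xy by (simp add: comm_entry_def)
        moreover have "P (n s - \<alpha> (s - 1) s t) dvd P (n (s - 1) - \<alpha> s (s - 1) t) * P (n s - n (s - 1))"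
          unfolding power_add[symmetric] using gap upper_fun_commute[OF lev(3,4)]
          by (intro le_imp_power_dvd) simp
        moreover have "P (n (s - 1) - \<alpha> s (s - 1) t) * P (n s - n (s - 1)) dvd
            (int p * ent a r v) * P (n s - n (s - 1))"
          using pdvd[OF r(1) v(1) v(2)[symmetric]] lev(1) r(2) by (intro mult_dvd_mono) simp_all
        ultimately show ?thesis
          using dvd_trans[of "P (n s - \<alpha> (s - 1) s t)"] by (simp add: ac_simps)
      qed
      then have "P (n s - \<alpha> (s - 1) s t - 1) dvd comm_entry a x y r r"
        using power_dvd_mult_powerD[of "int p" "n s - \<alpha> (s - 1) s t" "comm_entry a x y r r" 1] by simp
      moreover have "p = 2 \<longrightarrow> 2 \<le> n s - n (s - 1)" using cond single lev by blast
      moreover have "P (n s - \<alpha> s s t) dvd comm_entry a x y r r - c * u r"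
        using bspec[OF cu(2) r(1)] by (simp only: r(2))
      moreover have "P (n (s - 1) - \<alpha> (s - 1) (s - 1) t) dvd - comm_entry a x y r r - c * u v"
        using bspec[OF cu(2) v(1)] by (simp only: lev(1) neg)
      ultimately have "P (n s - \<alpha> s s t) dvd c"
        using dvd_of_diagonal_commutator[OF _ p lev(2) t bspec[OF cu(1) r(1)] bspec[OF cu(1) v(1)]]
        by blast
      then show ?thesis using cu(3) by blast
    qed
  qed
qed

end

section \<open>The upper central series\<close>

context matrix_ring
begin

lemma D_inverse:
  assumes "x \<in> carrier D"
  obtains y where "y \<in> carrier D" "x \<otimes> y = \<one>" "y \<otimes> x = \<one>"
proof -
  interpret D: group D by (rule group_D)
  show thesis
    using that[of "inv\<^bsub>D\<^esub> x"] D.r_inv[OF assms] D.l_inv[OF assms] assms by simp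
qed

lemma D_mult_closed: "x \<in> carrier D \<Longrightarrow> y \<in> carrier D \<Longrightarrow> x \<otimes> y \<in> carrier D"
  using group_D group.is_monoid[of D] monoid.m_closed[of D x y] by simp

lemma D_commutator:
  assumes a: "a \<in> rad" and b: "b \<in> rad"
  obtains k where "k \<in> rad"
    "(a \<oplus> \<one>) \<otimes>\<^bsub>D\<^esub> (b \<oplus> \<one>) \<otimes>\<^bsub>D\<^esub> inv\<^bsub>D\<^esub> (a \<oplus> \<one>) \<otimes>\<^bsub>D\<^esub> inv\<^bsub>D\<^esub> (b \<oplus> \<one>) = k \<oplus> \<one>"
    "k \<otimes> ((b \<oplus> \<one>) \<otimes> (a \<oplus> \<one>)) = comm a b"
proof -
  interpret D: group D by (rule group_D)
  let ?x = "a \<oplus> \<one>" and ?y = "b \<oplus> \<one>"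
  let ?c = "?x \<otimes>\<^bsub>D\<^esub> ?y \<otimes>\<^bsub>D\<^esub> inv\<^bsub>D\<^esub> ?x \<otimes>\<^bsub>D\<^esub> inv\<^bsub>D\<^esub> ?y"
  have x: "?x \<in> carrier D" and y: "?y \<in> carrier D" using a b by (auto simp: carrier_D)
  have "?c \<in> carrier D" using x y by (simp only: D.m_closed D.inv_closed)
  then obtain k where k: "k \<in> rad" "?c = k \<oplus> \<one>" by (auto simp: carrier_D)
  have R: "a \<in> carrier R" "b \<in> carrier R" "k \<in> carrier R" "?y \<otimes> ?x \<in> carrier R" using a b k by simp_all
  have "?c \<otimes>\<^bsub>D\<^esub> (?y \<otimes>\<^bsub>D\<^esub> ?x) = ?x \<otimes>\<^bsub>D\<^esub> ?y \<otimes>\<^bsub>D\<^esub> (inv\<^bsub>D\<^esub> ?x \<otimes>\<^bsub>D\<^esub> (inv\<^bsub>D\<^esub> ?y \<otimes>\<^bsub>D\<^esub> ?y \<otimes>\<^bsub>D\<^esub> ?x))"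
    using x y by (simp only: D.m_assoc D.m_closed D.inv_closed)
  also have "\<dots> = ?x \<otimes>\<^bsub>D\<^esub> ?y"
    using x y by (simp only: D.l_inv D.l_one D.r_one D.m_closed)
  finally have "(k \<oplus> \<one>) \<otimes> (?y \<otimes> ?x) = ?x \<otimes> ?y" unfolding k(2) by simp
  then have "k \<otimes> (?y \<otimes> ?x) \<oplus> ?y \<otimes> ?x = ?x \<otimes> ?y" using R by (simp add: l_distr)
  then have "?x \<otimes> ?y \<ominus> ?y \<otimes> ?x = k \<otimes> (?y \<otimes> ?x)"
    using R by (metis (no_types) add_diff_cancel_right[of "k \<otimes> (?y \<otimes> ?x)" "?y \<otimes> ?x" \<zero>] l_zero m_closed
      minus_eq minus_zero r_zero zero_closed)
  moreover have "?x \<otimes> ?y \<ominus> ?y \<otimes> ?x = comm a b"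
    using R add_diff_cancel_right[of "a \<otimes> b" "a \<oplus> b \<oplus> \<one>" "b \<otimes> a"]
    by (simp add: one_plus_mult comm_def a_comm[of b a])
  ultimately show thesis using that k by simp
qed

lemma cen_comm:
  assumes a: "a \<in> cen t" and b: "b \<in> carrier R"
  obtains j where "j \<in> ann t" "comm a b = comm j b"
proof -
  obtain c where c: "a \<ominus> smul c \<one> \<in> ann t" and aR: "a \<in> carrier R" using a by (auto simp: cen_def)
  define j where "j = a \<ominus> smul c \<one>"
  have j: "j \<in> ann t" "j \<in> carrier R" using c by (simp_all add: j_def)
  have "a = j \<oplus> smul c \<one>" unfolding j_def using aR by (simp add: diff_add_cancel)
  then have "a \<otimes> b = j \<otimes> b \<oplus> smul c b" "b \<otimes> a = b \<otimes> j \<oplus> smul c b"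
    using j b by (simp_all add: l_distr r_distr smul_one_mult mult_smul_one)
  then have "comm a b = comm j b"
    using j b by (simp add: comm_def add_diff_cancel_right)
  then show thesis using that j by blast
qed

lemma ann_subset_cen:
  assumes "a \<in> ann t"
  shows "a \<in> cen t"
proof -
  have "smul 0 \<one> = \<zero>" by (simp add: add_pow_def int_pow_def2)
  then have "a \<ominus> smul 0 \<one> = a" using assms by (simp add: minus_eq)
  then show ?thesis
    unfolding cen_def using assms ann_rad[OF assms] dvd_0_right[of "int p"]
    by (intro CollectI conjI exI[of _ 0]) simp_all
qed

lemma plus_one_cancel: "a \<in> carrier R \<Longrightarrow> b \<in> carrier R \<Longrightarrow> a \<oplus> \<one> = b \<oplus> \<one> \<longleftrightarrow> a = b"
  by simp

lemma upper_central_D: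
  assumes r: "r \<in> Ix" "fst r = s"
    and cond: "(p = 2 \<longrightarrow> 2 \<le> s \<longrightarrow> 2 \<le> n s - n (s - 1)) \<or> (\<exists>r'\<in>Ix. fst r' = s \<and> r' \<noteq> r)"
    and t: "1 \<le> t"
  shows "upper_central D t = {a \<oplus> \<one> | a. a \<in> cen t}"
proof -
  \<comment> \<open>At \<open>t = 0\<close> the central series has only \<one>, whereas
    \<open>cen 0\<close> contains all scalars divisible by \<open>p\<close>; hence the separate
    clause for \<open>t = 0\<close>.\<close>
  have Suc_eq: "upper_central D (Suc t) = {a \<oplus> \<one> | a. a \<in> cen (Suc t)}"
    if IH: "\<And>k. k \<in> rad \<Longrightarrow> k \<oplus> \<one> \<in> upper_central D t \<longleftrightarrow> (if t = 0 then k = \<zero> else k \<in> cen t)" for t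
  proof (rule Set.set_eqI, rule iffI)
    fix x assume x: "x \<in> upper_central D (Suc t)"
    then obtain a where a: "a \<in> rad" "x = a \<oplus> \<one>" by (auto simp: carrier_D)
    have aR: "a \<in> carrier R" using a by simp
    have scalar: "if t = 0 then comm a b \<in> ann t else
      \<exists>c. int p dvd c \<and> comm a b \<ominus> smul c ((b \<oplus> \<one>) \<otimes> (a \<oplus> \<one>)) \<in> ann t" if b: "b \<in> rad" for b
    proof -
      let ?w = "(b \<oplus> \<one>) \<otimes> (a \<oplus> \<one>)"
      have wR: "?w \<in> carrier R" using a b by simp
      obtain k where k: "k \<in> rad"
        "(a \<oplus> \<one>) \<otimes>\<^bsub>D\<^esub> (b \<oplus> \<one>) \<otimes>\<^bsub>D\<^esub> inv\<^bsub>D\<^esub> (a \<oplus> \<one>) \<otimes>\<^bsub>D\<^esub> inv\<^bsub>D\<^esub> (b \<oplus> \<one>) = k \<oplus> \<one>"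
        "k \<otimes> ?w = comm a b"
        using D_commutator[OF a(1) b] by blast
      have "b \<oplus> \<one> \<in> carrier D" using b by (auto simp: carrier_D)
      then have "k \<oplus> \<one> \<in> upper_central D t"
        using x unfolding a(2) upper_central.simps k(2)[symmetric] by blast
      then have kt: "if t = 0 then k = \<zero> else k \<in> cen t" using IH[OF k(1)] by simp
      show ?thesis
      proof (cases "t = 0")
        case True
        then show ?thesis using kt k(3) wR by (simp flip: k(3))
      next
        case False
        then obtain c where c: "int p dvd c" "k \<ominus> smul c \<one> \<in> ann t"
          using kt by (auto simp: cen_def)
        have "(k \<ominus> smul c \<one>) \<otimes> ?w = comm a b \<ominus> smul c ?w"
        proof -
          have "(k \<ominus> smul c \<one>) \<otimes> ?w = k \<otimes> ?w \<ominus> smul c \<one> \<otimes> ?w"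
            using k(1) wR by (simp only: minus_eq l_distr l_minus rad_closed a_inv_closed
                add.int_pow_closed one_closed)
          then show ?thesis using k(3) smul_one_mult[OF wR] by simp
        qed
        then show ?thesis using ann_mult_right[OF c(2) wR] c(1) False by auto
      qed
    qed
    have "comm a (F y v) \<in> ann t" if yv: "y \<in> Ix" "v \<in> Ix" "adj y v" for y v
    proof (cases "t = 0")
      case True
      then show ?thesis using scalar[OF F_rad[OF yv(1,2)]] by simp
    next
      case False
      then have t: "1 \<le> t" by simp
      show ?thesis
        by (rule comm_F_of_scalar[OF t a(1) r cond _ yv]) (use scalar False in auto)
    qed
    then have "a \<ominus> smul (ent a r r) \<one> \<in> ann (Suc t)" by (rule cen_of_comm_F[OF a(1) r])
    then show "x \<in> {a \<oplus> \<one> | a. a \<in> cen (Suc t)}" using a cen_eq[OF r, of "Suc t"] by blast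
  next
    fix x assume "x \<in> {a \<oplus> \<one> | a. a \<in> cen (Suc t)}"
    then obtain a where a: "a \<in> cen (Suc t)" "x = a \<oplus> \<one>" by blast
    then have arad: "a \<in> rad" by (simp add: cen_def)
    have "x \<otimes>\<^bsub>D\<^esub> y \<otimes>\<^bsub>D\<^esub> inv\<^bsub>D\<^esub> x \<otimes>\<^bsub>D\<^esub> inv\<^bsub>D\<^esub> y \<in> upper_central D t" if "y \<in> carrier D" for y
    proof -
      obtain b where b: "b \<in> rad" "y = b \<oplus> \<one>" using \<open>y \<in> carrier D\<close> by (auto simp: carrier_D)
      let ?w = "(b \<oplus> \<one>) \<otimes> (a \<oplus> \<one>)"
      obtain k where k: "k \<in> rad"
        "(a \<oplus> \<one>) \<otimes>\<^bsub>D\<^esub> (b \<oplus> \<one>) \<otimes>\<^bsub>D\<^esub> inv\<^bsub>D\<^esub> (a \<oplus> \<one>) \<otimes>\<^bsub>D\<^esub> inv\<^bsub>D\<^esub> (b \<oplus> \<one>) = k \<oplus> \<one>"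
        "k \<otimes> ?w = comm a b"
        using D_commutator[OF arad b(1)] by blast
      obtain j where j: "j \<in> ann (Suc t)" "comm a b = comm j b"
        using cen_comm[OF a(1) rad_closed[OF b(1)]] by blast
      \<comment> \<open>The scalar part of \<open>a\<close> drops out of the commutator; dividing by
        the unit \<open>?w\<close> afterwards keeps \<open>k\<close> in the ideal
        \<open>ann t\<close>.\<close>
      have "comm a b \<in> ann t"
      proof -
        have "j \<otimes> b \<in> ann t" "b \<otimes> j \<in> ann t" using j(1) b(1) by (simp_all add: ann_Suc)
        then show ?thesis unfolding j(2) by (simp only: comm_def ann_diff)
      qed
      have "a \<oplus> \<one> \<in> carrier D" "b \<oplus> \<one> \<in> carrier D" using arad b by (auto simp: carrier_D)
      then have "?w \<in> carrier D" by (intro D_mult_closed)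
      then obtain w' where w': "w' \<in> carrier D" "?w \<otimes> w' = \<one>" using D_inverse by blast
      have R: "k \<in> carrier R" "?w \<in> carrier R" "w' \<in> carrier R"
        using k(1) arad b w' carrier_D_R by simp_all
      have "k = comm a b \<otimes> w'"
        using w'(2) m_assoc[OF R] R unfolding k(3)[symmetric] by simp
      then have "k \<in> ann t" using ann_mult_right[OF \<open>comm a b \<in> ann t\<close> R(3)] by simp
      then have "if t = 0 then k = \<zero> else k \<in> cen t"
        using ann_subset_cen by (auto simp: ann_0)
      then show ?thesis using IH[OF k(1)] unfolding a(2) b(2) k(2) by simp
    qed
    moreover have "x \<in> carrier D" using a(2) arad by (auto simp: carrier_D)
    ultimately show "x \<in> upper_central D (Suc t)" by simp
  qed
  from t show ?thesis
  proof (induction t rule: dec_induct)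
    case base
    have "k \<oplus> \<one> \<in> upper_central D 0 \<longleftrightarrow> k = \<zero>" if "k \<in> rad" for k
      using plus_one_cancel[of k \<zero>] that by simp
    then have "upper_central D (Suc 0) = {a \<oplus> \<one> | a. a \<in> cen (Suc 0)}" by (intro Suc_eq) simp
    then show ?case by (simp only: One_nat_def)
  next
    case (step t)
    have "k \<oplus> \<one> \<in> upper_central D t \<longleftrightarrow> (if t = 0 then k = \<zero> else k \<in> cen t)" if "k \<in> rad" for k
    proof -
      have "k \<oplus> \<one> = a \<oplus> \<one> \<longleftrightarrow> k = a" if "a \<in> cen t" for a
        using that \<open>k \<in> rad\<close> plus_one_cancel[of k a] by (simp add: cen_def)
      then have "k \<oplus> \<one> \<in> {a \<oplus> \<one> | a. a \<in> cen t} \<longleftrightarrow> k \<in> cen t" by blast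
      then show ?thesis using step.IH step.hyps(1) by simp
    qed
    then show ?case by (rule Suc_eq)
  qed
qed

section \<open>Central units and the product with \<open>Z\<close>\<close>

lemma central_unit:
  assumes r: "r \<in> Ix" "fst r = s"
  shows "ring_center R \<inter> carrier D = {smul c \<one> | c. [c = 1] (mod int p)}"
proof (rule Set.set_eqI, rule iffI)
  fix z assume "z \<in> ring_center R \<inter> carrier D"
  then have zR: "z \<in> carrier R" and z: "\<And>b. b \<in> carrier R \<Longrightarrow> z \<otimes> b = b \<otimes> z" and zD: "z \<in> carrier D"
    by (auto simp: ring_center_def)
  have comm: "[(if v = y then ent z u x * g else 0) = (if u = x then g * ent z y v else 0)] (mod P (n (fst v)))"
    if "x \<in> Ix" "y \<in> Ix" "P (n (fst y) - n (fst x)) dvd g" "u \<in> Ix" "v \<in> Ix" for x y u v g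
    using cong_trans[OF cong_sym[OF ent_mult_E[OF that(1-3) zR that(4,5)]]]
      ent_E_mult[OF that(1-3) zR that(4,5)] z[OF E_closed[OF that(1-3)]] by simp
  have "z = smul (ent z r r) \<one>"
  proof (rule ent_eqI)
    fix x y assume xy: "x \<in> Ix" "y \<in> Ix"
    have "[ent z x y = (if x = y then ent z r r else 0)] (mod P (n (fst y)))"
    proof (cases "x = y")
      case True
      \<comment> \<open>Entries out of the top level are unrestricted, so the elementary matrix with
        1 at \<open>(r, y)\<close> is admissible; commuting with it equates the diagonal entries at
        \<open>r\<close> and \<open>y\<close>.\<close>
      have "n (fst y) \<le> n (fst r)" using xy(2) r(2) by (intro n_le) auto
      then have "P (n (fst y) - n (fst r)) dvd 1" by simp
      from comm[OF r(1) xy(2) this r(1) xy(2)] True show ?thesis by (simp add: cong_sym_eq)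
    next
      case False
      have "P (n (fst y) - n (fst y)) dvd 1" by simp
      from comm[OF xy(2) xy(2) this xy] False show ?thesis by simp
    qed
    then show "[ent z x y = ent (smul (ent z r r) \<one>) x y] (mod P (n (fst y)))"
      using cong_trans cong_sym[OF ent_scalar_one[OF xy]] by blast
  qed (use zR in simp_all)
  moreover have "[ent z r r = 1] (mod int p)"
  proof -
    obtain a where a: "a \<in> rad" "z = a \<oplus> \<one>" using zD by (auto simp: carrier_D)
    have "[ent z r r = ent a r r + ent \<one> r r] (mod int p)"
      unfolding a(2) using a(1) r(1) by (intro cong_dvd_modulus[OF ent_add p_dvd_q[OF r(1)]]) simp_all
    also have "[ent a r r + ent \<one> r r = 0 + 1] (mod int p)"
      using radD[OF a(1) r(1,1)] cong_dvd_modulus[OF ent_one[OF r(1,1)] p_dvd_q[OF r(1)]]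
      by (intro cong_add) (simp_all add: cong_0_iff)
    finally show ?thesis by simp
  qed
  ultimately show "z \<in> {smul c \<one> | c. [c = 1] (mod int p)}" by blast
next
  fix z assume "z \<in> {smul c \<one> | c. [c = 1] (mod int p)}"
  then obtain c where c: "z = smul c \<one>" "int p dvd c - 1" by (auto simp: cong_iff_dvd_diff)
  have "z = smul (c - 1) \<one> \<oplus> \<one>"
    using add.int_pow_mult[OF one_closed, of "c - 1" 1] c(1) by simp
  then have "z \<in> carrier D" using smul_rad[OF c(2)] by (auto simp: carrier_D)
  moreover have "z \<in> ring_center R" using c(1) by (simp add: ring_center_def smul_one_mult mult_smul_one)
  ultimately show "z \<in> ring_center R \<inter> carrier D" by simp
qed

text \<open>With \<open>z = 1 + c\<close> and its inverse \<open>z'\<close>, the element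
  \<open>1 + j + c\<close> factors as \<open>(j z' + 1) z\<close>; the ideal \<open>ann t\<close>
  absorbs \<open>z'\<close>, and \<open>z\<close> in the other direction.\<close>

lemma plus_one_cen_eq:
  assumes r: "r \<in> Ix" "fst r = s"
  shows "{a \<oplus> \<one> | a. a \<in> cen t} = (ann t +> \<one>) <#> (ring_center R \<inter> carrier D)"
proof (rule Set.set_eqI, rule iffI)
  fix x assume "x \<in> {a \<oplus> \<one> | a. a \<in> cen t}"
  then obtain a c where a: "x = a \<oplus> \<one>" "a \<in> rad" and c: "int p dvd c" "a \<ominus> smul c \<one> \<in> ann t"
    by (auto simp: cen_def)
  define z where "z = smul (c + 1) \<one>"
  have z: "z \<in> ring_center R \<inter> carrier D"
    unfolding central_unit[OF r] z_def using c(1) by (auto simp: cong_iff_dvd_diff)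
  then obtain z' where z': "z' \<in> carrier D" "z' \<otimes> z = \<one>" using D_inverse by blast
  have R: "a \<in> carrier R" "z \<in> carrier R" "z' \<in> carrier R" using a z z'(1) carrier_D_R by auto
  let ?j = "a \<ominus> smul c \<one>"
  have jR: "?j \<in> carrier R" using c(2) by simp
  have "z = smul c \<one> \<oplus> \<one>"
    using add.int_pow_mult[OF one_closed, of c 1] z_def by simp
  then have "x = ?j \<oplus> z"
    using a(1) R(1) diff_add_cancel[OF R(1), of "smul c \<one>"] by (simp flip: a_assoc)
  also have "\<dots> = (?j \<otimes> z' \<oplus> \<one>) \<otimes> z" using R jR z'(2) by (simp add: l_distr m_assoc)
  finally show "x \<in> (ann t +> \<one>) <#> (ring_center R \<inter> carrier D)"
    using ann_mult_right[OF c(2) R(3)] z unfolding set_mult_def a_r_coset_def' by blast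
next
  fix x assume "x \<in> (ann t +> \<one>) <#> (ring_center R \<inter> carrier D)"
  then obtain j z where j: "j \<in> ann t" and z: "z \<in> ring_center R \<inter> carrier D" and x: "x = (j \<oplus> \<one>) \<otimes> z"
    unfolding set_mult_def a_r_coset_def' by blast
  obtain c where c: "z = smul c \<one>" "int p dvd c - 1"
    using z unfolding central_unit[OF r] by (auto simp: cong_iff_dvd_diff)
  have R: "j \<in> carrier R" "z \<in> carrier R" using j c by simp_all
  let ?a = "j \<otimes> z \<oplus> smul (c - 1) \<one>"
  have jz: "j \<otimes> z \<in> ann t" by (rule ann_mult_right[OF j R(2)])
  have "z = smul (c - 1) \<one> \<oplus> \<one>"
    using add.int_pow_mult[OF one_closed, of "c - 1" 1] c(1) by simp
  then have "x = ?a \<oplus> \<one>" using x R by (simp add: l_distr a_assoc)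
  moreover have "?a \<in> rad" by (rule rad_add[OF ann_rad[OF jz] smul_rad[OF c(2)]])
  moreover have "?a \<ominus> smul (c - 1) \<one> = j \<otimes> z"
    using R by (simp add: minus_eq a_assoc r_neg)
  ultimately show "x \<in> {a \<oplus> \<one> | a. a \<in> cen t}"
    using c(2) jz unfolding cen_def by force
qed

end

section \<open>Endomorphism rings of groups with coordinates\<close>

context comm_group
begin

lemma carrier_End_ring: "carrier (End_ring G) = hom G G \<inter> extensional (carrier G)"
  and add_End_ring: "f \<oplus>\<^bsub>End_ring G\<^esub> g = (\<lambda>x\<in>carrier G. f x \<otimes> g x)"
  and mult_End_ring: "f \<otimes>\<^bsub>End_ring G\<^esub> g = compose (carrier G) g f"
  and one_End_ring: "\<one>\<^bsub>End_ring G\<^esub> = (\<lambda>x\<in>carrier G. x)"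
  and zero_End_ring: "\<zero>\<^bsub>End_ring G\<^esub> = (\<lambda>x\<in>carrier G. \<one>)"
  by (simp_all add: End_ring_def)

lemma End_ringI:
  assumes "\<And>x. x \<in> carrier G \<Longrightarrow> f x \<in> carrier G"
    and "\<And>x y. x \<in> carrier G \<Longrightarrow> y \<in> carrier G \<Longrightarrow> f (x \<otimes> y) = f x \<otimes> f y"
  shows "(\<lambda>x\<in>carrier G. f x) \<in> carrier (End_ring G)"
  using assms by (auto simp: carrier_End_ring hom_def)

lemma
  assumes "f \<in> carrier (End_ring G)"
  shows End_ring_closed [simp]: "x \<in> carrier G \<Longrightarrow> f x \<in> carrier G"
    and End_ring_mult: "x \<in> carrier G \<Longrightarrow> y \<in> carrier G \<Longrightarrow> f (x \<otimes> y) = f x \<otimes> f y"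
    and End_ring_extensional: "f \<in> extensional (carrier G)"
    and End_ring_one: "f \<one> = \<one>"
    and End_ring_int_pow: "x \<in> carrier G \<Longrightarrow> f (x [^] (m :: int)) = f x [^] m"
  using assms hom_one[of f G G] hom_int_pow[of f G G x m]
  by (auto simp: carrier_End_ring hom_def)

lemma End_ring_eqI:
  assumes "f \<in> carrier (End_ring G)" "g \<in> carrier (End_ring G)"
    and "\<And>x. x \<in> carrier G \<Longrightarrow> f x = g x"
  shows "f = g"
  using assms by (intro extensionalityI[of f "carrier G" g] End_ring_extensional)

lemma End_ring_add_closed:
  assumes "f \<in> carrier (End_ring G)" "g \<in> carrier (End_ring G)"
  shows "f \<oplus>\<^bsub>End_ring G\<^esub> g \<in> carrier (End_ring G)"
  unfolding add_End_ring using assms by (intro End_ringI) (auto simp: End_ring_mult m_ac)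

lemma End_ring_mult_closed:
  assumes "f \<in> carrier (End_ring G)" "g \<in> carrier (End_ring G)"
  shows "f \<otimes>\<^bsub>End_ring G\<^esub> g \<in> carrier (End_ring G)"
  unfolding mult_End_ring compose_def using assms by (intro End_ringI) (auto simp: End_ring_mult)

lemma zero_End_ring_closed: "\<zero>\<^bsub>End_ring G\<^esub> \<in> carrier (End_ring G)"
  unfolding zero_End_ring by (intro End_ringI) auto

lemma one_End_ring_closed: "\<one>\<^bsub>End_ring G\<^esub> \<in> carrier (End_ring G)"
  unfolding one_End_ring by (intro End_ringI) auto

lemma ring_End_ring: "ring (End_ring G)"
proof (rule ringI)
  show "abelian_group (End_ring G)"
  proof (rule abelian_groupI)
    fix f assume f: "f \<in> carrier (End_ring G)"
    show "\<exists>g\<in>carrier (End_ring G). g \<oplus>\<^bsub>End_ring G\<^esub> f = \<zero>\<^bsub>End_ring G\<^esub>"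
    proof
      show g: "(\<lambda>x\<in>carrier G. inv f x) \<in> carrier (End_ring G)"
        using f by (intro End_ringI) (auto simp: End_ring_mult inv_mult)
      show "(\<lambda>x\<in>carrier G. inv f x) \<oplus>\<^bsub>End_ring G\<^esub> f = \<zero>\<^bsub>End_ring G\<^esub>"
        by (rule End_ring_eqI[OF End_ring_add_closed[OF g f] zero_End_ring_closed])
          (use f in \<open>simp add: add_End_ring zero_End_ring\<close>)
    qed
    show "\<zero>\<^bsub>End_ring G\<^esub> \<oplus>\<^bsub>End_ring G\<^esub> f = f"
      by (rule End_ring_eqI[OF End_ring_add_closed[OF zero_End_ring_closed f] f])
        (use f in \<open>simp add: add_End_ring zero_End_ring\<close>)
  next
    fix f g h assume f: "f \<in> carrier (End_ring G)" and g: "g \<in> carrier (End_ring G)"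
      and h: "h \<in> carrier (End_ring G)"
    show "f \<oplus>\<^bsub>End_ring G\<^esub> g \<oplus>\<^bsub>End_ring G\<^esub> h = f \<oplus>\<^bsub>End_ring G\<^esub> (g \<oplus>\<^bsub>End_ring G\<^esub> h)"
      by (rule End_ring_eqI; (intro End_ring_add_closed f g h)?)
        (use f g h in \<open>simp add: add_End_ring m_assoc\<close>)
  next
    fix f g assume f: "f \<in> carrier (End_ring G)" and g: "g \<in> carrier (End_ring G)"
    show "f \<oplus>\<^bsub>End_ring G\<^esub> g = g \<oplus>\<^bsub>End_ring G\<^esub> f"
      by (rule End_ring_eqI; (intro End_ring_add_closed f g)?)
        (use f g in \<open>simp add: add_End_ring m_comm\<close>)
  qed (intro End_ring_add_closed zero_End_ring_closed; assumption)+
  show "monoid (End_ring G)"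
  proof (rule monoidI)
    fix f g h assume f: "f \<in> carrier (End_ring G)" and g: "g \<in> carrier (End_ring G)"
      and h: "h \<in> carrier (End_ring G)"
    show "f \<otimes>\<^bsub>End_ring G\<^esub> g \<otimes>\<^bsub>End_ring G\<^esub> h = f \<otimes>\<^bsub>End_ring G\<^esub> (g \<otimes>\<^bsub>End_ring G\<^esub> h)"
      by (rule End_ring_eqI; (intro End_ring_mult_closed f g h)?)
        (use f g h in \<open>simp add: mult_End_ring compose_eq\<close>)
  next
    fix f assume f: "f \<in> carrier (End_ring G)"
    show "\<one>\<^bsub>End_ring G\<^esub> \<otimes>\<^bsub>End_ring G\<^esub> f = f"
      by (rule End_ring_eqI; (intro End_ring_mult_closed one_End_ring_closed f)?)
        (use f in \<open>simp add: mult_End_ring one_End_ring compose_eq\<close>)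
    show "f \<otimes>\<^bsub>End_ring G\<^esub> \<one>\<^bsub>End_ring G\<^esub> = f"
      by (rule End_ring_eqI; (intro End_ring_mult_closed one_End_ring_closed f)?)
        (use f in \<open>simp add: mult_End_ring one_End_ring compose_eq\<close>)
  qed (intro End_ring_mult_closed one_End_ring_closed; assumption)+
next
  fix f g h assume f: "f \<in> carrier (End_ring G)" and g: "g \<in> carrier (End_ring G)"
    and h: "h \<in> carrier (End_ring G)"
  show "(f \<oplus>\<^bsub>End_ring G\<^esub> g) \<otimes>\<^bsub>End_ring G\<^esub> h = f \<otimes>\<^bsub>End_ring G\<^esub> h \<oplus>\<^bsub>End_ring G\<^esub> g \<otimes>\<^bsub>End_ring G\<^esub> h"
    by (rule End_ring_eqI; (intro End_ring_mult_closed End_ring_add_closed f g h)?)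
      (use f g h in \<open>simp add: add_End_ring mult_End_ring compose_eq End_ring_mult\<close>)
  show "h \<otimes>\<^bsub>End_ring G\<^esub> (f \<oplus>\<^bsub>End_ring G\<^esub> g) = h \<otimes>\<^bsub>End_ring G\<^esub> f \<oplus>\<^bsub>End_ring G\<^esub> h \<otimes>\<^bsub>End_ring G\<^esub> g"
    by (rule End_ring_eqI; (intro End_ring_mult_closed End_ring_add_closed f g h)?)
      (use f g h in \<open>simp add: add_End_ring mult_End_ring compose_eq\<close>)
qed

end

text \<open>Coordinates as canonical representatives. Finite support and equality of elements with
  equal coordinates take the place of sums over a possibly infinite basis.\<close>

locale coordinate_group = level_chain s n + comm_group G
  for s :: nat and n :: "nat \<Rightarrow> nat" and G :: "('a, 'm) monoid_scheme" (structure) +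
  fixes p :: nat
    and B :: "nat \<Rightarrow> 'b set"
    and co :: "'a \<Rightarrow> nat \<times> 'b \<Rightarrow> int"
    and e :: "nat \<times> 'b \<Rightarrow> 'a"
  assumes p: "Factorial_Ring.prime p"
    and B_nonempty: "i \<in> {1..s} \<Longrightarrow> B i \<noteq> {}"
    and co_range: "v \<in> carrier G \<Longrightarrow> z \<in> Sigma {1..s} B \<Longrightarrow> co v z \<in> {0..<int p ^ n (fst z)}"
    and co_mult: "\<lbrakk>v \<in> carrier G; v' \<in> carrier G; z \<in> Sigma {1..s} B\<rbrakk> \<Longrightarrow>
      [co (v \<otimes> v') z = co v z + co v' z] (mod int p ^ n (fst z))"
    and co_eqI: "\<lbrakk>v \<in> carrier G; v' \<in> carrier G; \<And>z. z \<in> Sigma {1..s} B \<Longrightarrow> co v z = co v' z\<rbrakk>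
      \<Longrightarrow> v = v'"
    and co_finite: "v \<in> carrier G \<Longrightarrow> finite {z \<in> Sigma {1..s} B. co v z \<noteq> 0}"
    and e_closed: "z \<in> Sigma {1..s} B \<Longrightarrow> e z \<in> carrier G"
    and co_e: "\<lbrakk>y \<in> Sigma {1..s} B; z \<in> Sigma {1..s} B\<rbrakk> \<Longrightarrow> co (e y) z = (if z = y then 1 else 0)"
begin

abbreviation "Ix \<equiv> Sigma {1..s} B"

lemma p_pos [simp]: "0 < p" using p by (rule prime_gt_0_nat)

lemma co_cong_eq:
  assumes "v \<in> carrier G" "v' \<in> carrier G" "z \<in> Ix" "[co v z = co v' z] (mod int p ^ n (fst z))"
  shows "co v z = co v' z"
  using assms(4) co_range[OF assms(1,3)] co_range[OF assms(2,3)]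
  by (intro cong_less_imp_eq_int[of _ "int p ^ n (fst z)"]) auto

lemma co_cong_eqI:
  assumes "v \<in> carrier G" "v' \<in> carrier G"
    "\<And>z. z \<in> Ix \<Longrightarrow> [co v z = co v' z] (mod int p ^ n (fst z))"
  shows "v = v'"
  using assms co_cong_eq by (intro co_eqI) blast+

lemma co_one_cong: "z \<in> Ix \<Longrightarrow> [co \<one> z = 0] (mod int p ^ n (fst z))"
  using co_mult[of \<one> \<one> z] cong_add_lcancel_0[of "co \<one> z" "co \<one> z"] by (simp add: cong_sym_eq)

lemma co_one: "z \<in> Ix \<Longrightarrow> co \<one> z = 0"
  using co_one_cong[of z] co_range[of \<one> z] by (intro cong_less_imp_eq_int[of _ "int p ^ n (fst z)"]) auto

lemma co_int_pow:
  assumes "v \<in> carrier G" "z \<in> Ix"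
  shows "[co (v [^] (m :: int)) z = m * co v z] (mod int p ^ n (fst z))"
proof (induction m rule: int_induct[where k = 0])
  case base
  then show ?case using co_one_cong assms by simp
next
  case (step1 m)
  have "v [^] (m + 1) = v [^] m \<otimes> v" using assms int_pow_mult[of v m 1] by simp
  then have "[co (v [^] (m + 1)) z = co (v [^] m) z + co v z] (mod int p ^ n (fst z))"
    using co_mult[of "v [^] m" v z] assms by simp
  also have "[co (v [^] m) z + co v z = m * co v z + co v z] (mod int p ^ n (fst z))"
    by (intro cong_add step1.IH cong_refl)
  finally show ?case by (simp add: algebra_simps)
next
  case (step2 m)
  have "v [^] (m - 1) \<otimes> v = v [^] m" using assms int_pow_mult[of v "m - 1" 1] by simp
  then have "[co (v [^] m) z = co (v [^] (m - 1)) z + co v z] (mod int p ^ n (fst z))"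
    using co_mult[of "v [^] (m - 1)" v z] assms by simp
  from cong_trans[OF cong_sym[OF this] step2.IH]
  show ?case by (simp add: cong_iff_dvd_diff algebra_simps)
qed

lemma co_e_int_pow:
  assumes "y \<in> Ix" "z \<in> Ix"
  shows "[co (e y [^] (m :: int)) z = (if z = y then m else 0)] (mod int p ^ n (fst z))"
  using co_int_pow[OF e_closed[OF assms(1)] assms(2), of m] co_e[OF assms] by (simp split: if_splits)

lemma e_int_pow_cong:
  assumes "y \<in> Ix" "[m = m'] (mod int p ^ n (fst y))"
  shows "e y [^] (m :: int) = e y [^] m'"
proof (rule co_cong_eqI)
  fix z assume z: "z \<in> Ix"
  have "[(if z = y then m else 0) = (if z = y then m' else 0)] (mod int p ^ n (fst z))"
    using assms(2) by simp
  then show "[co (e y [^] m) z = co (e y [^] m') z] (mod int p ^ n (fst z))"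
    using co_e_int_pow[OF assms(1) z] cong_trans cong_sym by metis
qed (use assms e_closed in simp_all)

text \<open>Stands in for expanding \<open>f v\<close> over the basis: the induction strips one
  nonzero coordinate at a time. It gives the divisibility of product entries as well as the fact
  that an endomorphism is determined on the basis.\<close>

lemma dvd_co_hom:
  assumes f: "f \<in> carrier (End_ring G)" and y: "y \<in> Ix" and d: "d dvd int p ^ n (fst y)"
    and v: "v \<in> carrier G" "\<And>z. z \<in> Ix \<Longrightarrow> d dvd co v z * co (f (e z)) y"
  shows "d dvd co (f v) y"
  using v
proof (induction "card {z \<in> Ix. co v z \<noteq> 0}" arbitrary: v rule: less_induct)
  case less
  show ?case
  proof (cases "\<forall>z\<in>Ix. co v z = 0")
    case True
    then have "v = \<one>" using less.prems(1) co_one by (intro co_eqI) auto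
    then show ?thesis using co_one[OF y] End_ring_one[OF f] by simp
  next
    case False
    then obtain z where z: "z \<in> Ix" "co v z \<noteq> 0" by blast
    define v' where "v' = v \<otimes> e z [^] (- co v z)"
    have ez: "e z \<in> carrier G" using z e_closed by blast
    have v': "v' \<in> carrier G" using less.prems(1) ez by (simp add: v'_def)
    have co_v': "co v' u = (if u = z then 0 else co v u)" if u: "u \<in> Ix" for u
    proof -
      have "[co v' u = co v u + co (e z [^] (- co v z)) u] (mod int p ^ n (fst u))"
        unfolding v'_def using less.prems(1) ez u by (intro co_mult) simp_all
      also have "[co v u + co (e z [^] (- co v z)) u = co v u + (if u = z then - co v z else 0)]
          (mod int p ^ n (fst u))"
        by (intro cong_add cong_refl co_e_int_pow z u)
      also have "co v u + (if u = z then - co v z else 0) = (if u = z then 0 else co v u)" by simp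
      finally show ?thesis
        using co_range[OF v' u] co_range[OF less.prems(1) u]
        by (intro cong_less_imp_eq_int[of _ "int p ^ n (fst u)"]) (auto split: if_splits)
    qed
    have "{u \<in> Ix. co v' u \<noteq> 0} \<subset> {u \<in> Ix. co v u \<noteq> 0}"
    proof (rule psubsetI)
      show "{u \<in> Ix. co v' u \<noteq> 0} \<subseteq> {u \<in> Ix. co v u \<noteq> 0}" using co_v' by (auto split: if_splits)
      have "z \<notin> {u \<in> Ix. co v' u \<noteq> 0}" using co_v'[OF z(1)] by simp
      then show "{u \<in> Ix. co v' u \<noteq> 0} \<noteq> {u \<in> Ix. co v u \<noteq> 0}" using z by blast
    qed
    then have "card {u \<in> Ix. co v' u \<noteq> 0} < card {u \<in> Ix. co v u \<noteq> 0}"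
      by (rule psubset_card_mono[OF co_finite[OF less.prems(1)]])
    then have IH: "d dvd co (f v') y"
      using v' less.prems(2) co_v' by (intro less.hyps) auto
    have "v = v' \<otimes> e z [^] co v z"
      unfolding v'_def using less.prems(1) ez by (simp add: m_assoc int_pow_neg)
    then have "f v = f (v' \<otimes> e z [^] co v z)" by (rule arg_cong)
    also have "\<dots> = f v' \<otimes> f (e z) [^] co v z"
      using f v' ez by (simp add: End_ring_mult End_ring_int_pow)
    finally have "[co (f v) y = co (f v') y + co (f (e z) [^] co v z) y] (mod int p ^ n (fst y))"
      using co_mult[of "f v'" "f (e z) [^] co v z" y] f v' ez y by simp
    also have "[co (f v') y + co (f (e z) [^] co v z) y = co (f v') y + co v z * co (f (e z)) y]
        (mod int p ^ n (fst y))"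
      using f ez y by (intro cong_add cong_refl co_int_pow) simp_all
    finally show ?thesis
      using dvd_cong_iff[OF _ d] IH less.prems(2)[OF z(1)] by simp
  qed
qed

text \<open>\<open>dvd_co_hom\<close> is applied to the difference, with the full modulus as
  divisor.\<close>

lemma End_ring_eq_on_basis:
  assumes f: "f \<in> carrier (End_ring G)" and g: "g \<in> carrier (End_ring G)"
    and eq: "\<And>z. z \<in> Ix \<Longrightarrow> f (e z) = g (e z)"
  shows "f = g"
proof -
  interpret R: ring "End_ring G" by (rule ring_End_ring)
  define h where "h = f \<ominus>\<^bsub>End_ring G\<^esub> g"
  have h: "h \<in> carrier (End_ring G)" and fh: "f = h \<oplus>\<^bsub>End_ring G\<^esub> g"
    unfolding h_def using f g by (simp_all add: R.diff_add_cancel)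
  have "h (e z) = \<one>" if "z \<in> Ix" for z
    using fun_cong[OF fh, of "e z"] eq[OF that] e_closed[OF that] g h by (simp add: add_End_ring)
  then have *: "int p ^ n (fst y) dvd co (h v) y" if "v \<in> carrier G" "y \<in> Ix" for v y
    using that h co_one by (intro dvd_co_hom) auto
  have "h v = \<one>" if v: "v \<in> carrier G" for v
  proof (rule co_cong_eqI)
    fix z assume "z \<in> Ix"
    then show "[co (h v) z = co \<one> z] (mod int p ^ n (fst z))"
      using *[OF v] by (simp add: co_one cong_0_iff)
  qed (use v h in simp_all)
  then have "f v = g v" if "v \<in> carrier G" for v
    using fun_cong[OF fh, of v] that g by (simp add: add_End_ring)
  then show ?thesis using f g by (intro End_ring_eqI)
qed

definition entry :: "('a \<Rightarrow> 'a) \<Rightarrow> nat \<times> 'b \<Rightarrow> nat \<times> 'b \<Rightarrow> int" where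
  "entry f x y = co (f (e x)) y"

definition elementary :: "nat \<times> 'b \<Rightarrow> nat \<times> 'b \<Rightarrow> int \<Rightarrow> 'a \<Rightarrow> 'a" where
  "elementary x y g = (\<lambda>v\<in>carrier G. e y [^] (g * co v x))"

lemma elementary_closed:
  assumes x: "x \<in> Ix" and y: "y \<in> Ix" and g: "int p ^ (n (fst y) - n (fst x)) dvd g"
  shows "elementary x y g \<in> carrier (End_ring G)"
  unfolding elementary_def
proof (rule End_ringI)
  fix v v' assume v: "v \<in> carrier G" "v' \<in> carrier G"
  have ey: "e y \<in> carrier G" using y e_closed by blast
  \<comment> \<open>The coordinate at \<open>x\<close> is additive only modulo
    \<open>p ^ n (fst x)\<close>; the divisibility of \<open>g\<close> lifts this to the order of
    \<open>e y\<close>.\<close>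
  have "int p ^ n (fst y) dvd int p ^ (n (fst y) - n (fst x)) * int p ^ n (fst x)"
    unfolding power_add[symmetric] by (intro le_imp_power_dvd) simp
  also have "\<dots> dvd g * (co (v \<otimes> v') x - (co v x + co v' x))"
    using g co_mult[OF v x] by (intro mult_dvd_mono) (simp_all add: cong_iff_dvd_diff)
  finally have "[g * co (v \<otimes> v') x = g * co v x + g * co v' x] (mod int p ^ n (fst y))"
    by (simp add: cong_iff_dvd_diff algebra_simps)
  then show "e y [^] (g * co (v \<otimes> v') x) = e y [^] (g * co v x) \<otimes> e y [^] (g * co v' x)"
    using e_int_pow_cong[OF y] ey by (simp add: int_pow_mult)
qed (use y e_closed in simp)

lemma matrix_ring_End_ring: "matrix_ring s n (End_ring G) p B entry elementary"
proof -
  interpret R: ring "End_ring G" by (rule ring_End_ring)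
  show ?thesis
  proof
    fix f g x y assume fg: "f \<in> carrier (End_ring G)" "g \<in> carrier (End_ring G)" and xy: "x \<in> Ix" "y \<in> Ix"
    show "[entry (f \<oplus>\<^bsub>End_ring G\<^esub> g) x y = entry f x y + entry g x y] (mod int p ^ n (fst y))"
      using co_mult[of "f (e x)" "g (e x)" y] fg xy e_closed by (simp add: entry_def add_End_ring)
    show "d dvd entry (f \<otimes>\<^bsub>End_ring G\<^esub> g) x y"
      if "d dvd int p ^ n (fst y)" "\<And>z. z \<in> Ix \<Longrightarrow> d dvd entry f x z * entry g z y" for d
    proof -
      have "d dvd co (g (f (e x))) y"
        using that fg e_closed[OF xy(1)] by (intro dvd_co_hom xy) (auto simp: entry_def)
      then show ?thesis using e_closed[OF xy(1)] by (simp add: entry_def mult_End_ring compose_eq)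
    qed
  next
    fix x y assume xy: "x \<in> Ix" "y \<in> Ix"
    show "[entry \<one>\<^bsub>End_ring G\<^esub> x y = (if x = y then 1 else 0)] (mod int p ^ n (fst y))"
      using co_e[OF xy] e_closed[OF xy(1)] by (auto simp: entry_def one_End_ring)
  next
    fix f g assume f: "f \<in> carrier (End_ring G)" and g: "g \<in> carrier (End_ring G)"
      and eq: "\<And>x y. x \<in> Ix \<Longrightarrow> y \<in> Ix \<Longrightarrow> [entry f x y = entry g x y] (mod int p ^ n (fst y))"
    show "f = g"
    proof (rule End_ring_eq_on_basis[OF f g])
      fix z assume z: "z \<in> Ix"
      show "f (e z) = g (e z)"
        by (rule co_cong_eqI) (use f g z e_closed eq in \<open>auto simp: entry_def\<close>)
    qed
  next
    fix f x y assume f: "f \<in> carrier (End_ring G)" and xy: "x \<in> Ix" "y \<in> Ix"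
    have ex: "e x \<in> carrier G" using xy e_closed by blast
    \<comment> \<open>The image of \<open>e x\<close> is killed by \<open>p ^ n (fst x)\<close> as
      well, which forces the divisibility of its coordinates at higher levels.\<close>
    have "e x [^] (int p ^ n (fst x)) = e x [^] (0 :: int)"
      by (rule e_int_pow_cong[OF xy(1)]) (simp add: cong_0_iff)
    then have "f (e x) [^] (int p ^ n (fst x)) = \<one>"
      using End_ring_int_pow[OF f ex, of "int p ^ n (fst x)"] End_ring_one[OF f] by simp
    then have "[0 = int p ^ n (fst x) * co (f (e x)) y] (mod int p ^ n (fst y))"
      using co_int_pow[of "f (e x)" y "int p ^ n (fst x)"] f ex xy(2) co_one by simp
    then have "int p ^ n (fst y) dvd entry f x y * int p ^ n (fst x)"
      by (simp add: entry_def cong_sym_eq[of 0] cong_0_iff mult.commute)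
    then show "int p ^ (n (fst y) - n (fst x)) dvd entry f x y"
      by (intro power_dvd_mult_powerD) auto
  next
    fix x y g f z v assume x: "x \<in> Ix" and y: "y \<in> Ix" and g: "int p ^ (n (fst y) - n (fst x)) dvd g"
      and f: "f \<in> carrier (End_ring G)" and z: "z \<in> Ix" and v: "v \<in> Ix"
    have cl: "e x \<in> carrier G" "e y \<in> carrier G" "e z \<in> carrier G" using x y z e_closed by blast+
    show "[entry (f \<otimes>\<^bsub>End_ring G\<^esub> elementary x y g) z v = (if v = y then entry f z x * g else 0)]
        (mod int p ^ n (fst v))"
      using co_e_int_pow[OF y v, of "g * co (f (e z)) x"] f cl
      by (cases "v = y") (simp_all add: entry_def mult_End_ring compose_eq elementary_def mult.commute)
    have "[co (f (e y) [^] (g * co (e z) x)) v = (g * co (e z) x) * co (f (e y)) v] (mod int p ^ n (fst v))"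
      using f cl v by (intro co_int_pow) simp_all
    then show "[entry (elementary x y g \<otimes>\<^bsub>End_ring G\<^esub> f) z v = (if z = x then g * entry f y v else 0)]
        (mod int p ^ n (fst v))"
      using co_e[OF z x] f cl
      by (simp add: entry_def mult_End_ring compose_eq elementary_def End_ring_int_pow split: if_splits)
  qed (use p B_nonempty elementary_closed in auto)
qed

end

section \<open>Transfer to the given isomorphism and its matrix entries\<close>

lemma (in matrix_ring) mem_cen_iff:
  assumes "(s, r) \<in> Sigma {1..s} B"
  shows "a \<in> cen t \<longleftrightarrow> a \<in> carrier R \<and> a \<oplus> \<one> \<in> carrier D \<and>
    (\<forall>i\<in>{1..s}. \<forall>j\<in>{1..s}. i \<noteq> j \<longrightarrow> (\<forall>l\<in>B i. \<forall>k\<in>B j.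
       [ent a (i, l) (j, k) = 0] (mod int p ^ (n j - \<alpha> i j t)))) \<and>
    (\<forall>i\<in>{1..s}. \<forall>l\<in>B i.
       [ent a (i, l) (i, l) = ent a (s, r) (s, r)] (mod int p ^ (n i - \<alpha> i i t))) \<and>
    (\<forall>i\<in>{1..s}. \<forall>l\<in>B i. \<forall>k\<in>B i. l \<noteq> k \<longrightarrow>
       [ent a (i, l) (i, k) = 0] (mod int p ^ (n i - \<alpha> i i t)))"
    (is "_ \<longleftrightarrow> _ \<and> _ \<and> ?off \<and> ?diag \<and> ?level")
proof -
  let ?c = "ent a (s, r) (s, r)"
  have D: "a \<in> carrier R \<and> a \<oplus> \<one> \<in> carrier D \<longleftrightarrow> a \<in> rad"
    unfolding carrier_D using plus_one_cancel[of a] rad_closed by blast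
  have "a \<in> cen t \<longleftrightarrow> a \<in> rad \<and> a \<ominus> smul ?c \<one> \<in> ann t"
    using cen_eq[OF assms] by simp
  also have "\<dots> \<longleftrightarrow> a \<in> rad \<and>
      (\<forall>x\<in>Ix. \<forall>y\<in>Ix. P (n (fst y) - \<alpha> (fst x) (fst y) t) dvd ent a x y - (if x = y then ?c else 0))"
    using diff_smul_ann[OF _ radD[OF _ assms assms refl]] by blast
  also have "(\<forall>x\<in>Ix. \<forall>y\<in>Ix. P (n (fst y) - \<alpha> (fst x) (fst y) t) dvd ent a x y - (if x = y then ?c else 0)) \<longleftrightarrow>
      (\<forall>i\<in>{1..s}. \<forall>l\<in>B i. \<forall>j\<in>{1..s}. \<forall>k\<in>B j.
        [ent a (i, l) (j, k) = (if i = j \<and> l = k then ?c else 0)] (mod P (n j - \<alpha> i j t)))"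
    by (simp add: cong_iff_dvd_diff)
  also have "\<dots> \<longleftrightarrow> ?off \<and> ?diag \<and> ?level"
  proof (intro iffI conjI ballI impI; (elim conjE)?)
    fix i l j k assume "?off" "?diag" "?level" and ij: "i \<in> {1..s}" "l \<in> B i" "j \<in> {1..s}" "k \<in> B j"
    then show "[ent a (i, l) (j, k) = (if i = j \<and> l = k then ?c else 0)] (mod P (n j - \<alpha> i j t))"
      by (cases "i = j"; cases "l = k") auto
  qed fastforce+
  finally show ?thesis using D by blast
qed

lemma card_gt_1_obtain:
  assumes "infinite A \<or> 1 < card A"
  obtains b where "b \<in> A" "b \<noteq> a"
proof -
  have "\<not> A \<subseteq> {a}"
    using assms card_mono[of "{a}" A] finite_subset[of A "{a}"] by auto
  then show thesis using that by blast
qed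

lemma min_gap_le: "2 \<le> s \<Longrightarrow> min_gap s n \<le> enat (n s - n (s - 1))"
  unfolding min_gap_def by (rule INF_lower) simp

lemma coordinate_group_of_iso:
  fixes G (structure)
  assumes "comm_group G" and p: "Factorial_Ring.prime p" and "level_chain s n"
    and B: "\<forall>i\<in>{1..s}. B i \<noteq> {}"
    and \<phi>: "\<phi> \<in> iso G (homocyclic_sum p s n B)"
  shows "coordinate_group s n G p B (\<lambda>v z. \<phi> v (fst z) (snd z))
    (\<lambda>z. inv_into (carrier G) \<phi> (basis_vector s B (fst z) (snd z)))"
proof -
  interpret comm_group G by fact
  interpret level_chain s n by fact
  let ?H = "homocyclic_sum p s n B"
  have group_level: "group (homocyclic_group (p ^ n i) (B i))" for i
    unfolding homocyclic_group_def by simp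
  have carrier_level: "carrier (homocyclic_group (p ^ n i) (B i)) =
      {x \<in> \<Pi>\<^sub>E k\<in>B i. {0..<int p ^ n i}. finite {k \<in> B i. x k \<noteq> 0}}" for i
    unfolding homocyclic_group_def
    using prime_gt_0_nat[OF p] by (simp add: carrier_sum_group carrier_integer_mod_group)
  have carrier_H: "carrier ?H =
      {x \<in> \<Pi>\<^sub>E i\<in>{1..s}. carrier (homocyclic_group (p ^ n i) (B i)).
        finite {i \<in> {1..s}. x i \<noteq> \<one>\<^bsub>homocyclic_group (p ^ n i) (B i)\<^esub>}}"
    unfolding homocyclic_sum_def by (rule carrier_sum_group) (rule group_level)
  have mult_H: "(x \<otimes>\<^bsub>?H\<^esub> y) i k = (x i k + y i k) mod int p ^ n i" if "i \<in> {1..s}" "k \<in> B i" for x y i k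
    using that by (simp add: homocyclic_sum_def homocyclic_group_def)
  have hom: "\<phi> \<in> hom G ?H" and inj: "inj_on \<phi> (carrier G)" and surj: "\<phi> ` carrier G = carrier ?H"
    using \<phi> by (auto simp: iso_def bij_betw_def)
  have \<phi>_H: "\<phi> v \<in> carrier ?H" if "v \<in> carrier G" for v using that surj by blast
  have \<phi>_level: "\<phi> v i \<in> carrier (homocyclic_group (p ^ n i) (B i))" if "v \<in> carrier G" "i \<in> {1..s}" for v i
    using \<phi>_H[OF that(1)] that(2) unfolding carrier_H by (auto simp del: atLeastAtMost_iff)
  have basis_H: "basis_vector s B i l \<in> carrier ?H" if "i \<in> {1..s}" "l \<in> B i" for i l
  proof -
    have "(\<lambda>k\<in>B j. if j = i \<and> k = l then 1 else 0) \<in> carrier (homocyclic_group (p ^ n j) (B j))"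
      if "j \<in> {1..s}" for j
    proof -
      \<comment> \<open>This makes the coordinate 1 of a basis vector a canonical
        representative.\<close>
      have "1 < int p ^ n j" using n_gt0[of j] that prime_gt_1_nat[OF p] by (intro one_less_power) auto
      moreover have "finite {k \<in> B j. j = i \<and> k = l}" by (rule finite_subset[of _ "{l}"]) auto
      ultimately show ?thesis
        unfolding carrier_level using prime_gt_0_nat[OF p] by (auto simp: PiE_def Pi_def cong: conj_cong)
    qed
    then show ?thesis unfolding carrier_H basis_vector_def by (simp del: atLeastAtMost_iff)
  qed
  have basis: "\<phi> (inv_into (carrier G) \<phi> (basis_vector s B i l)) = basis_vector s B i l"
    "inv_into (carrier G) \<phi> (basis_vector s B i l) \<in> carrier G" if "i \<in> {1..s}" "l \<in> B i" for i l
    using basis_H[OF that] surj f_inv_into_f[of _ \<phi> "carrier G"] inv_into_into[of _ \<phi> "carrier G"] by simp_all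
  show ?thesis
  proof
    show "Factorial_Ring.prime p" by (rule p)
    show "B i \<noteq> {}" if "i \<in> {1..s}" for i using B that by blast
  next
    fix v z assume v: "v \<in> carrier G" and z: "z \<in> Sigma {1..s} B"
    then have z': "fst z \<in> {1..s}" "snd z \<in> B (fst z)" by auto
    show "\<phi> v (fst z) (snd z) \<in> {0..<int p ^ n (fst z)}"
      using \<phi>_level[OF v z'(1)] z'(2) unfolding carrier_level by (auto simp: PiE_def Pi_def)
    fix v' assume v': "v' \<in> carrier G"
    show "[\<phi> (v \<otimes> v') (fst z) (snd z) = \<phi> v (fst z) (snd z) + \<phi> v' (fst z) (snd z)] (mod int p ^ n (fst z))"
      using hom_mult[OF hom v v'] mult_H[OF z'] by (simp add: cong_def)
  next
    fix v v' assume v: "v \<in> carrier G" and v': "v' \<in> carrier G"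
      and eq: "\<And>z. z \<in> Sigma {1..s} B \<Longrightarrow> \<phi> v (fst z) (snd z) = \<phi> v' (fst z) (snd z)"
    have "\<phi> v i = \<phi> v' i" if i: "i \<in> {1..s}" for i
    proof (rule extensionalityI[of _ "B i"])
      show "\<phi> v i \<in> extensional (B i)" "\<phi> v' i \<in> extensional (B i)"
        using \<phi>_level[OF v i] \<phi>_level[OF v' i] unfolding carrier_level by (auto simp: PiE_def)
      show "\<phi> v i k = \<phi> v' i k" if "k \<in> B i" for k using eq[of "(i, k)"] i that by simp
    qed
    then have "\<phi> v = \<phi> v'"
      using \<phi>_H[OF v] \<phi>_H[OF v'] unfolding carrier_H
      by (intro extensionalityI[of _ "{1..s}"]) (simp_all add: PiE_def)
    then show "v = v'" using inj v v' by (simp add: inj_on_def)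
  next
    fix v assume v: "v \<in> carrier G"
    have "finite (Sigma {1..s} (\<lambda>i. {k \<in> B i. \<phi> v i k \<noteq> 0}))"
      using \<phi>_level[OF v] unfolding carrier_level by (intro finite_SigmaI) auto
    moreover have "{z \<in> Sigma {1..s} B. \<phi> v (fst z) (snd z) \<noteq> 0} =
        Sigma {1..s} (\<lambda>i. {k \<in> B i. \<phi> v i k \<noteq> 0})" by auto
    ultimately show "finite {z \<in> Sigma {1..s} B. \<phi> v (fst z) (snd z) \<noteq> 0}" by simp
  next
    fix y assume y: "y \<in> Sigma {1..s} B"
    then have y': "fst y \<in> {1..s}" "snd y \<in> B (fst y)" by auto
    show "inv_into (carrier G) \<phi> (basis_vector s B (fst y) (snd y)) \<in> carrier G"
      by (rule basis(2)[OF y'])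
    fix z assume "z \<in> Sigma {1..s} B"
    then have z': "fst z \<in> {1..s}" "snd z \<in> B (fst z)" by auto
    show "\<phi> (inv_into (carrier G) \<phi> (basis_vector s B (fst y) (snd y))) (fst z) (snd z) =
        (if z = y then 1 else 0)"
      unfolding basis(1)[OF y'] using z' by (simp add: basis_vector_def prod_eq_iff del: atLeastAtMost_iff)
  qed
qed

theorem theorem1p1:
  fixes G :: "('a, 'm) monoid_scheme"
    and p s t :: nat
    and n :: "nat \<Rightarrow> nat"
    and B :: "nat \<Rightarrow> 'b set"
    and \<phi> :: "'a \<Rightarrow> nat \<Rightarrow> 'b \<Rightarrow> int"
    and r :: 'b
  assumes "comm_group G"
    and "Factorial_Ring.prime p"
    and "1 \<le> s"
    and "0 < n 1"
    and "strict_mono_on {1..s} n"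
    and "\<forall>i\<in>{1..s}. B i \<noteq> {}"
    and "\<phi> \<in> iso G (homocyclic_sum p s n B)"
    and "r \<in> B s"
    and "3 \<le> p \<or>
         (p = 2 \<and> 2 \<le> min_gap s n) \<or>
         (p = 2 \<and> (infinite (B s) \<or> 1 < card (B s)) \<and> 2 \<le> s)"
    and "1 \<le> t"
  shows "upper_central (Delta G) t =
           (upper_annihilating (End_ring G) t +>\<^bsub>End_ring G\<^esub> \<one>\<^bsub>End_ring G\<^esub>)
             <#>\<^bsub>End_ring G\<^esub> (ring_center (End_ring G) \<inter> carrier (Delta G)) \<and>
         upper_central (Delta G) t =
           {C \<oplus>\<^bsub>End_ring G\<^esub> \<one>\<^bsub>End_ring G\<^esub> | C.
              C \<in> carrier (End_ring G) \<and>
              C \<oplus>\<^bsub>End_ring G\<^esub> \<one>\<^bsub>End_ring G\<^esub> \<in> carrier (Delta G) \<and>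
              (\<forall>i\<in>{1..s}. \<forall>j\<in>{1..s}. i \<noteq> j \<longrightarrow> (\<forall>l\<in>B i. \<forall>k\<in>B j.
                 [matrix_entry G \<phi> s B C i j l k = 0]
                   (mod int p ^ (n j - upper_fun s n i j t)))) \<and>
              (\<forall>i\<in>{1..s}. \<forall>l\<in>B i.
                 [matrix_entry G \<phi> s B C i i l l = matrix_entry G \<phi> s B C s s r r]
                   (mod int p ^ (n i - upper_fun s n i i t))) \<and>
              (\<forall>i\<in>{1..s}. \<forall>l\<in>B i. \<forall>k\<in>B i. l \<noteq> k \<longrightarrow>
                 [matrix_entry G \<phi> s B C i i l k = 0]
                   (mod int p ^ (n i - upper_fun s n i i t)))}"
proof -
  interpret level_chain s n using assms(3-5) by unfold_locales
  interpret C: coordinate_group s n G p B "\<lambda>v z. \<phi> v (fst z) (snd z)"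
    "\<lambda>z. inv_into (carrier G) \<phi> (basis_vector s B (fst z) (snd z))"
    by (rule coordinate_group_of_iso) (use assms level_chain_axioms in auto)
  interpret M: matrix_ring s n "End_ring G" p B C.entry C.elementary
    by (rule C.matrix_ring_End_ring)
  have D: "M.D = Delta G" by (simp add: M.D_def Delta_def)
  have entry: "C.entry f (i, l) (j, k) = matrix_entry G \<phi> s B f i j l k" for f i l j k
    by (simp add: C.entry_def matrix_entry_def)
  have r: "(s, r) \<in> Sigma {1..s} B" using assms(3,8) by simp
  \<comment> \<open>All three alternatives reduce to the dichotomy of
    \<open>comm_F_of_scalar\<close>; its first half is vacuous for odd \<open>p\<close>, and for
    \<open>s = 1\<close>, where \<open>min_gap\<close> is infinite.\<close>
  have "(p = 2 \<longrightarrow> 2 \<le> s \<longrightarrow> 2 \<le> n s - n (s - 1)) \<or> (\<exists>r'\<in>Sigma {1..s} B. fst r' = s \<and> r' \<noteq> (s, r))"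
    using assms(9)
  proof (elim disjE conjE)
    assume gap: "2 \<le> min_gap s n"
    show ?thesis
    proof (intro disjI1 impI)
      assume "2 \<le> s"
      from order_trans[OF gap min_gap_le[OF this, of n]] show "2 \<le> n s - n (s - 1)"
        by (simp only: numeral_eq_enat enat_ord_simps)
    qed
  next
    assume "infinite (B s)"
    then obtain r' where "r' \<in> B s" "r' \<noteq> r" by (rule card_gt_1_obtain[OF disjI1])
    then show ?thesis using assms(3) by (intro disjI2 bexI[of _ "(s, r')"]) simp_all
  next
    assume "1 < card (B s)"
    then obtain r' where "r' \<in> B s" "r' \<noteq> r" by (rule card_gt_1_obtain[OF disjI2])
    then show ?thesis using assms(3) by (intro disjI2 bexI[of _ "(s, r')"]) simp_all
  qed simp
  then have cen: "upper_central (Delta G) t = {a \<oplus>\<^bsub>End_ring G\<^esub> \<one>\<^bsub>End_ring G\<^esub> | a. a \<in> M.cen t}"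
    using M.upper_central_D[OF r _ _ assms(10)] unfolding D by simp
  show ?thesis
  proof
    show "upper_central (Delta G) t =
        (upper_annihilating (End_ring G) t +>\<^bsub>End_ring G\<^esub> \<one>\<^bsub>End_ring G\<^esub>)
          <#>\<^bsub>End_ring G\<^esub> (ring_center (End_ring G) \<inter> carrier (Delta G))"
      unfolding cen unfolding M.upper_annihilating_eq_ann D[symmetric] by (rule M.plus_one_cen_eq[OF r]) simp
  qed (unfold cen, intro Collect_cong ex_cong1 conj_cong refl, rule M.mem_cen_iff[OF r, unfolded D entry])
qed

end
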